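(* Let $\pi_1:V_1\to X_1$ and $\pi_2:V_2\to X_2$ be two finite-dimensional locally trivial diffeological vector pseudo-bundles, and let $(\tilde f,f)$ be a gluing between them such that $f$ and $\tilde f^*$ are diffeomorphisms (of their domains with their images). Assume that there exist pseudo-metrics $g_1$ and $g_2$ on $V_1$ and $V_2$ respectively that are compatible with the gluing along $(\tilde f,f)$. Then $$\left((\Phi_{\cup,*}^{-1})^*\otimes(\Phi_{\cup,*}^{-1})^*\right)\circ\tilde g^*=\widetilde{g^*}\circ\varphi_{X_1\leftrightarrow X_2},$$ that is, for all $x\in X_1\cup_fX_2$ and all $v^*,w^*$ in the fibre of $V_2^*\cup_{\tilde f^*}V_1^*$ over $\varphi_{X_1\leftrightarrow X_2}(x)$, $$\widetilde{g^*}(\varphi_{X_1\leftrightarrow X_2}(x))(v^*,w^* )=\tilde g^*(x)\left(\Phi_{\cup,*}^{-1}(v^* ),\Phi_{\cup,*}^{-1}(w^* )\right).$$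
   Context: Diffeological spaces, plots, smooth maps, and the subset, quotient, product, disjoint union and functional diffeologies are in the usual sense of Souriau. A diffeological vector space is a real vector space with a diffeology making addition and scalar multiplication smooth; $E^*$ denotes the space of smooth linear maps $E\to\mathbb R$ ($\mathbb R$ with its usual diffeology), with the functional diffeology. Pseudo-bundles. A diffeological vector pseudo-bundle is a smooth surjective map $\pi:V\to X$ of diffeological spaces with a vector space structure on each fibre such that fibrewise addition $V\times_XV\to V$, scalar multiplication $\mathbb R\times V\to V$ and the zero section $X\to V$ are smooth. The dual pseudo-bundle is $V^*=\bigcup_{x\in X}(\pi^{-1}(x))^*$ with the obvious projection $\pi^*$; a map $q:U'\to V^*$ is a plot iff for every plot $p:U\to V$ the map $(u',u)\mapsto q(u')(p(u))$ is smooth on $\{(u',u):\pi^*(q(u'))=\pi(p(u))\}$ (subset diffeology). $V\otimes V'$ is the fibrewise tensor product, with the finest pseudo-bundle diffeology making $V\times_XV'\to V\otimes V'$ smooth. Pseudo-metrics. A pseudo-metric on a finite-dimensional diffeological vector space $E$ is a smooth symmetric positive semi-definite bilinear form of rank $\dim(E^* )$. A pseudo-metric on $\pi:V\to X$ (finite-dimensional fibres) is a smooth section $g$ of $V^*\otimes V^*$ with $g(x)$ a pseudo-metric on $\pi^{-1}(x)$ for all $x$. The dual (induced) pseudo-metric $g^*$ on $V^*$ is defined by $g^*(x)(\Psi_g(v),\Psi_g(w))=g(x)(v,w)$ for $v,w\in\pi^{-1}(x)$, where $\Psi_g:V\to V^*$, $\Psi_g(v)=g(\pi(v))(v,\cdot)$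 (a fibrewise surjective map). Gluing. For $h:Z_1\supseteq Y'\to Z_2$ smooth, $Z_1\cup_hZ_2=(Z_1\sqcup Z_2)/(z\sim h(z),\ z\in Y')$ with the quotient of the disjoint union diffeology. The natural inclusions $Z_1\setminus Y'\to Z_1\cup_hZ_2$ and $Z_2\to Z_1\cup_hZ_2$ have disjoint images covering $Z_1\cup_hZ_2$; for base spaces they are denoted $i_1^{Z_1},i_2^{Z_2}$ and for total spaces $j_1^{Z_1},j_2^{Z_2}$. A gluing $(\tilde f,f)$ of $\pi_1:V_1\to X_1$ to $\pi_2:V_2\to X_2$ consists of a smooth $f:X_1\supseteq Y\to X_2$ and a smooth fibrewise linear lift $\tilde f:\pi_1^{-1}(Y)\to V_2$ of $f$; it yields the pseudo-bundle $\pi_1\cup_{(\tilde f,f)}\pi_2:V_1\cup_{\tilde f}V_2\to X_1\cup_fX_2$. Pseudo-metrics $g_1,g_2$ on $V_1,V_2$ are compatible with $(\tilde f,f)$ if $g_1(y)(v,w)=g_2(f(y))(\tilde f(v),\tilde f(w))$ for all $y\in Y$, $v,w\in\pi_1^{-1}(y)$. If $f$ is a diffeomorphism with its image, $\tilde f^*:(\pi_2^* )^{-1}(f(Y))\to V_1^*$ is $\tilde f^*(\xi)=\xi\circ\tilde f|_{\pi_1^{-1}(y)}$ for $\xi\in(\pi_2^{-1}(f(y)))^*$; it is a lift of $f^{-1}:f(Y)\to X_1$ and gives the gluing $V_2^*\cup_{\tilde f^*}V_1^*\to X_2\cup_{f^{-1}}X_1$. Maps. The switch map $\varphi_{X_1\leftrightarrow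 X_2}:X_1\cup_fX_2\to X_2\cup_{f^{-1}}X_1$ is: $i_1^{X_1}(x)\mapsto i_2^{X_1}(x)$ for $x\in X_1\setminus Y$, $i_2^{X_2}(f(x))\mapsto i_2^{X_1}(x)$ for $x\in Y$, $i_2^{X_2}(x)\mapsto i_1^{X_2}(x)$ for $x\in X_2\setminus f(Y)$. The gluing-dual commutativity diffeomorphism (its existence is guaranteed by the hypotheses) is $\Phi_{\cup,*}:(V_1\cup_{\tilde f}V_2)^*\to V_2^*\cup_{\tilde f^*}V_1^*$, given by $j_2^{V_1^*}\circ(j_1^{V_1})^*$ over $i_1^{X_1}(X_1\setminus Y)$, by $j_2^{V_1^*}\circ\tilde f^*\circ(j_2^{V_2})^*$ over $i_2^{X_2}(f(Y))$, and by $j_1^{V_2^*}\circ(j_2^{V_2})^*$ over $i_2^{X_2}(X_2\setminus f(Y))$, where $(j_i^{V_i})^*$ is fibrewise pre-composition with $j_i^{V_i}$. Glued pseudo-metrics. $\tilde g$ is the pseudo-metric on $V_1\cup_{\tilde f}V_2$ with $\tilde g(i_1^{X_1}(x))(j_1^{V_1}v,j_1^{V_1}w)=g_1(x)(v,w)$ for $x\in X_1\setminus Y$ and $\tilde g(i_2^{X_2}(x))(j_2^{V_2}v,j_2^{V_2}w)=g_2(x)(v,w)$ for $x\in X_2$; $\tilde g^*$ is the dual of $\tilde g$, on $(V_1\cup_{\tilde f}V_2)^*$. $\widetilde{g^*}$ is the pseudo-metric on $V_2^*\cup_{\tilde f^*}V_1^*$ obtained in the same way from $g_2^*$ and $g_1^*$: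 it is $g_2^*$ on fibres over $i_1^{X_2}(X_2\setminus f(Y))$ (via $j_1^{V_2^*}$) and $g_1^*$ on fibres over $i_2^{X_1}(X_1)$ (via $j_2^{V_1^*}$). *)

theory Defs
  imports "HOL-Analysis.Analysis" "HOL-Algebra.AbelCoset" "Jordan_Normal_Form.VS_Connect"
begin

hide_const (open) Polynomial.smult

section \<open>Smooth functions on open subsets of the spaces \<open>\<real>\<^sup>n\<close>\<close>

text \<open>
  The dimension of a plot varies, so the space of dimension \<open>n\<close> is the library's
  topology \<^const>\<open>Euclidean_space\<close> \<open>n\<close>, carried by the sequences vanishing from index \<open>n\<close> on.
\<close>

definition partial_deriv :: "nat \<Rightarrow> ((nat \<Rightarrow> real) \<Rightarrow> real) \<Rightarrow> (nat \<Rightarrow> real) \<Rightarrow> real" where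
  "partial_deriv i f x = deriv (\<lambda>t. f (x(i := t))) (x i)"

primrec Ck_on :: "nat \<Rightarrow> nat \<Rightarrow> (nat \<Rightarrow> real) set \<Rightarrow> ((nat \<Rightarrow> real) \<Rightarrow> real) \<Rightarrow> bool" where
  "Ck_on n 0 U f \<longleftrightarrow> continuous_map (subtopology (Euclidean_space n) U) euclideanreal f"
| "Ck_on n (Suc k) U f \<longleftrightarrow>
     continuous_map (subtopology (Euclidean_space n) U) euclideanreal f \<and>
     (\<forall>i<n. (\<forall>x\<in>U. (\<lambda>t. f (x(i := t))) field_differentiable (at (x i))) \<and>
            Ck_on n k U (partial_deriv i f))"

definition smooth_fun :: "nat \<Rightarrow> (nat \<Rightarrow> real) set \<Rightarrow> ((nat \<Rightarrow> real) \<Rightarrow> real) \<Rightarrow> bool" where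
  "smooth_fun n U f \<longleftrightarrow> openin (Euclidean_space n) U \<and> (\<forall>k. Ck_on n k U f)"

definition smooth_param ::
  "nat \<Rightarrow> (nat \<Rightarrow> real) set \<Rightarrow> nat \<Rightarrow> (nat \<Rightarrow> real) set \<Rightarrow> ((nat \<Rightarrow> real) \<Rightarrow> (nat \<Rightarrow> real)) \<Rightarrow> bool" where
  "smooth_param m W n U F \<longleftrightarrow>
     openin (Euclidean_space m) W \<and> F ` W \<subseteq> U \<and> (\<forall>i<n. smooth_fun m W (\<lambda>w. F w i))"

section \<open>Diffeological spaces\<close>

text \<open>
  \<open>plots X n U p\<close> says that \<open>p\<close>, restricted to the open set \<open>U\<close> of the \<open>n\<close>-dimensional space,
  is a plot of \<open>X\<close>; the values of \<open>p\<close> outside \<open>U\<close> are irrelevant (second axiom below).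
\<close>

record 'a dspace =
  points :: "'a set"
  plots :: "nat \<Rightarrow> (nat \<Rightarrow> real) set \<Rightarrow> ((nat \<Rightarrow> real) \<Rightarrow> 'a) \<Rightarrow> bool"

definition diffeological_space :: "'a dspace \<Rightarrow> bool" where
  "diffeological_space X \<longleftrightarrow>
     (\<forall>n U p. plots X n U p \<longrightarrow> openin (Euclidean_space n) U \<and> p ` U \<subseteq> points X) \<and>
     (\<forall>n U p q. plots X n U p \<longrightarrow> (\<forall>u\<in>U. p u = q u) \<longrightarrow> plots X n U q) \<and>
     (\<forall>n U. \<forall>x\<in>points X. openin (Euclidean_space n) U \<longrightarrow> plots X n U (\<lambda>_. x)) \<and>
     (\<forall>n U p. openin (Euclidean_space n) U \<longrightarrow>
        (\<forall>u\<in>U. \<exists>W. openin (Euclidean_space n) W \<and> u \<in> W \<and> W \<subseteq> U \<and> plots X n W p) \<longrightarrow>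
        plots X n U p) \<and>
     (\<forall>n U p m W F. plots X n U p \<longrightarrow> smooth_param m W n U F \<longrightarrow> plots X m W (p \<circ> F))"

definition smooth_map :: "'a dspace \<Rightarrow> 'b dspace \<Rightarrow> ('a \<Rightarrow> 'b) \<Rightarrow> bool" where
  "smooth_map X Y f \<longleftrightarrow>
     f ` points X \<subseteq> points Y \<and> (\<forall>n U p. plots X n U p \<longrightarrow> plots Y n U (f \<circ> p))"

definition diffeomorphism :: "'a dspace \<Rightarrow> 'b dspace \<Rightarrow> ('a \<Rightarrow> 'b) \<Rightarrow> bool" where
  "diffeomorphism X Y f \<longleftrightarrow>
     bij_betw f (points X) (points Y) \<and> smooth_map X Y f \<and> smooth_map Y X (inv_into (points X) f)"

definition eucl_dspace :: "nat \<Rightarrow> (nat \<Rightarrow> real) set \<Rightarrow> (nat \<Rightarrow> real) dspace" where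
  "eucl_dspace n U = \<lparr>points = U, plots = (\<lambda>m W p. smooth_param m W n U p)\<rparr>"

definition real_dspace :: "real dspace" where
  "real_dspace = \<lparr>points = UNIV, plots = smooth_fun\<rparr>"

definition sub_dspace :: "'a dspace \<Rightarrow> 'a set \<Rightarrow> 'a dspace" where
  "sub_dspace X A =
     \<lparr>points = points X \<inter> A, plots = (\<lambda>n U p. plots X n U p \<and> p ` U \<subseteq> A)\<rparr>"

definition prod_dspace :: "'a dspace \<Rightarrow> 'b dspace \<Rightarrow> ('a \<times> 'b) dspace" where
  "prod_dspace X Y =
     \<lparr>points = points X \<times> points Y,
      plots = (\<lambda>n U p. plots X n U (fst \<circ> p) \<and> plots Y n U (snd \<circ> p))\<rparr>"

definition sum_dspace :: "'a dspace \<Rightarrow> 'b dspace \<Rightarrow> ('a + 'b) dspace" where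
  "sum_dspace X Y =
     \<lparr>points = Inl ` points X \<union> Inr ` points Y,
      plots = (\<lambda>n U p. openin (Euclidean_space n) U \<and>
        (\<forall>u\<in>U. \<exists>W. openin (Euclidean_space n) W \<and> u \<in> W \<and> W \<subseteq> U \<and>
           ((\<exists>q. plots X n W q \<and> (\<forall>w\<in>W. p w = Inl (q w))) \<or>
            (\<exists>q. plots Y n W q \<and> (\<forall>w\<in>W. p w = Inr (q w))))))\<rparr>"

definition quot_dspace :: "'a dspace \<Rightarrow> ('a \<times> 'a) set \<Rightarrow> 'a set dspace" where
  "quot_dspace X r =
     \<lparr>points = points X // r,
      plots = (\<lambda>n U p. openin (Euclidean_space n) U \<and>
        (\<forall>u\<in>U. \<exists>W. openin (Euclidean_space n) W \<and> u \<in> W \<and> W \<subseteq> U \<and>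
           (\<exists>q. plots X n W q \<and> (\<forall>w\<in>W. p w = r `` {q w}))))\<rparr>"

definition d_open :: "'a dspace \<Rightarrow> 'a set \<Rightarrow> bool" where
  "d_open X A \<longleftrightarrow>
     A \<subseteq> points X \<and> (\<forall>n U p. plots X n U p \<longrightarrow> openin (Euclidean_space n) {u \<in> U. p u \<in> A})"

section \<open>Vector spaces\<close>

text \<open>
  Real vector spaces are module records over \<open>class_ring\<close>, at type \<open>real\<close>. The components \<open>mult\<close> and \<open>one\<close> inherited from ring records play no role.
\<close>

abbreviation real_vectorspace :: "(real, 'v) module \<Rightarrow> bool" where
  "real_vectorspace M \<equiv> vectorspace class_ring M"

abbreviation linear_maps :: "(real, 'v) module \<Rightarrow> (real, 'w) module \<Rightarrow> ('v \<Rightarrow> 'w) set" where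
  "linear_maps M N \<equiv> module_hom class_ring M N"

abbreviation vdim :: "(real, 'v) module \<Rightarrow> nat" where
  "vdim M \<equiv> vectorspace.dim class_ring M"

abbreviation fun_module :: "'s set \<Rightarrow> (real, 's \<Rightarrow> real) module" where
  "fun_module S \<equiv> LinearCombinations.ring.func_space (class_ring :: real ring) S"

definition real_module :: "(real, real) module" where
  "real_module = \<lparr>carrier = UNIV, mult = (*), one = 1, zero = 0, add = (+), smult = (*)\<rparr>"

definition image_module :: "('v \<Rightarrow> 'w) \<Rightarrow> (real, 'v) module \<Rightarrow> (real, 'w) module" where
  "image_module j M =
     \<lparr>carrier = j ` carrier M,
      mult = (\<lambda>_ _. j \<zero>\<^bsub>M\<^esub>), one = j \<zero>\<^bsub>M\<^esub>, zero = j \<zero>\<^bsub>M\<^esub>,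
      add = (\<lambda>a b. j (inv_into (carrier M) j a \<oplus>\<^bsub>M\<^esub> inv_into (carrier M) j b)),
      smult = (\<lambda>r a. j (r \<odot>\<^bsub>M\<^esub> inv_into (carrier M) j a))\<rparr>"

definition diff_vector_space :: "(real, 'v) module \<Rightarrow> 'v dspace \<Rightarrow> bool" where
  "diff_vector_space M D \<longleftrightarrow>
     real_vectorspace M \<and> diffeological_space D \<and> points D = carrier M \<and>
     smooth_map (prod_dspace D D) D (\<lambda>(v, w). v \<oplus>\<^bsub>M\<^esub> w) \<and>
     smooth_map (prod_dspace real_dspace D) D (\<lambda>(r, v). r \<odot>\<^bsub>M\<^esub> v)"

text \<open>The elements of the smooth dual are normalised to be \<open>undefined\<close> outside the carrier.\<close>

definition smooth_dual :: "(real, 'v) module \<Rightarrow> 'v dspace \<Rightarrow> (real, 'v \<Rightarrow> real) module" where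
  "smooth_dual M D =
     (fun_module (carrier M))\<lparr>carrier :=
        {\<phi> \<in> extensional (carrier M). \<phi> \<in> linear_maps M real_module \<and> smooth_map D real_dspace \<phi>}\<rparr>"

definition form_rank :: "(real, 'v) module \<Rightarrow> ('v \<Rightarrow> 'v \<Rightarrow> real) \<Rightarrow> nat" where
  "form_rank M g =
     vdim ((fun_module (carrier M))\<lparr>carrier := (\<lambda>v. \<lambda>w\<in>carrier M. g v w) ` carrier M\<rparr>)"

definition vs_pseudo_metric ::
  "(real, 'v) module \<Rightarrow> 'v dspace \<Rightarrow> ('v \<Rightarrow> 'v \<Rightarrow> real) \<Rightarrow> bool" where
  "vs_pseudo_metric M D g \<longleftrightarrow>
     smooth_map (prod_dspace D D) real_dspace (\<lambda>(v, w). g v w) \<and>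
     (\<forall>v\<in>carrier M. (\<lambda>w. g v w) \<in> linear_maps M real_module) \<and>
     (\<forall>w\<in>carrier M. (\<lambda>v. g v w) \<in> linear_maps M real_module) \<and>
     (\<forall>v\<in>carrier M. \<forall>w\<in>carrier M. g v w = g w v) \<and>
     (\<forall>v\<in>carrier M. g v v \<ge> 0) \<and>
     form_rank M g = vdim (smooth_dual M D)"

text \<open>
  The tensor product is the free vector space on \<open>E \<times> F\<close> (finitely supported functions)
  modulo the span of the bilinearity relators; its elements are cosets.
\<close>

definition free_module :: "'s set \<Rightarrow> (real, 's \<Rightarrow> real) module" where
  "free_module S =
     (fun_module S)\<lparr>carrier := {c \<in> S \<rightarrow>\<^sub>E UNIV. finite {s \<in> S. c s \<noteq> 0}}\<rparr>"

definition free_gen :: "'s set \<Rightarrow> 's \<Rightarrow> ('s \<Rightarrow> real)" where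
  "free_gen S s = (\<lambda>t\<in>S. indicator {s} t)"

definition tensor_relators ::
  "(real, 'v) module \<Rightarrow> (real, 'w) module \<Rightarrow> ('v \<times> 'w \<Rightarrow> real) set" where
  "tensor_relators E F = (let S = carrier E \<times> carrier F; e = free_gen S in
     {\<lambda>t\<in>S. e (v \<oplus>\<^bsub>E\<^esub> v', w) t - e (v, w) t - e (v', w) t | v v' w.
        v \<in> carrier E \<and> v' \<in> carrier E \<and> w \<in> carrier F} \<union>
     {\<lambda>t\<in>S. e (v, w \<oplus>\<^bsub>F\<^esub> w') t - e (v, w) t - e (v, w') t | v w w'.
        v \<in> carrier E \<and> w \<in> carrier F \<and> w' \<in> carrier F} \<union>
     {\<lambda>t\<in>S. e (r \<odot>\<^bsub>E\<^esub> v, w) t - r * e (v, w) t | r v w. v \<in> carrier E \<and> w \<in> carrier F} \<union>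
     {\<lambda>t\<in>S. e (v, r \<odot>\<^bsub>F\<^esub> w) t - r * e (v, w) t | r v w. v \<in> carrier E \<and> w \<in> carrier F})"

definition tensor_null ::
  "(real, 'v) module \<Rightarrow> (real, 'w) module \<Rightarrow> ('v \<times> 'w \<Rightarrow> real) set" where
  "tensor_null E F =
     LinearCombinations.module.span class_ring (free_module (carrier E \<times> carrier F))
       (tensor_relators E F)"

definition tensor_module ::
  "(real, 'v) module \<Rightarrow> (real, 'w) module \<Rightarrow> (real, ('v \<times> 'w \<Rightarrow> real) set) module" where
  "tensor_module E F = (let L = free_module (carrier E \<times> carrier F); N = tensor_null E F in
     \<lparr>carrier = a_rcosets\<^bsub>L\<^esub> N, mult = (\<lambda>_ _. N), one = N, zero = N,
      add = (\<lambda>C D. C <+>\<^bsub>L\<^esub> D),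
      smult = (\<lambda>r C. N <+>\<^bsub>L\<^esub> ((\<lambda>c. r \<odot>\<^bsub>L\<^esub> c) ` C))\<rparr>)"

definition pure_tensor ::
  "(real, 'v) module \<Rightarrow> (real, 'w) module \<Rightarrow> 'v \<Rightarrow> 'w \<Rightarrow> ('v \<times> 'w \<Rightarrow> real) set" where
  "pure_tensor E F v w =
     tensor_null E F +>\<^bsub>free_module (carrier E \<times> carrier F)\<^esub> free_gen (carrier E \<times> carrier F) (v, w)"

section \<open>Diffeological vector pseudo-bundles\<close>

text \<open>\<open>fibre B x\<close> is the fibre of \<open>B\<close> over \<open>x\<close> together with its vector space structure.\<close>

record ('x, 'v) pbundle =
  base :: "'x dspace"
  total :: "'v dspace"
  proj :: "'v \<Rightarrow> 'x"
  fibre :: "'x \<Rightarrow> (real, 'v) module"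

definition fibre_product :: "('x, 'v) pbundle \<Rightarrow> ('x, 'w) pbundle \<Rightarrow> ('v \<times> 'w) dspace" where
  "fibre_product B C = sub_dspace (prod_dspace (total B) (total C)) {(v, w). proj B v = proj C w}"

definition over :: "('x, 'v) pbundle \<Rightarrow> 'x set \<Rightarrow> 'v set" where
  "over B A = {v \<in> points (total B). proj B v \<in> A}"

definition fibre_space :: "('x, 'v) pbundle \<Rightarrow> 'x \<Rightarrow> 'v dspace" where
  "fibre_space B x = sub_dspace (total B) (over B {x})"

definition pseudo_bundle :: "('x, 'v) pbundle \<Rightarrow> bool" where
  "pseudo_bundle B \<longleftrightarrow>
     diffeological_space (base B) \<and> diffeological_space (total B) \<and>
     smooth_map (total B) (base B) (proj B) \<and> proj B ` points (total B) = points (base B) \<and>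
     (\<forall>x\<in>points (base B). real_vectorspace (fibre B x) \<and> carrier (fibre B x) = over B {x}) \<and>
     smooth_map (fibre_product B B) (total B) (\<lambda>(v, w). v \<oplus>\<^bsub>fibre B (proj B v)\<^esub> w) \<and>
     smooth_map (prod_dspace real_dspace (total B)) (total B)
       (\<lambda>(r, v). r \<odot>\<^bsub>fibre B (proj B v)\<^esub> v) \<and>
     smooth_map (base B) (total B) (\<lambda>x. \<zero>\<^bsub>fibre B x\<^esub>)"

definition finite_dimensional :: "('x, 'v) pbundle \<Rightarrow> bool" where
  "finite_dimensional B \<longleftrightarrow> (\<forall>x\<in>points (base B). vectorspace.fin_dim class_ring (fibre B x))"

text \<open>
  Local triviality is taken over open sets of the D-topology of the base. Taking the typical fibre
  on the type \<open>'v\<close> is no restriction, as it is isomorphic to a fibre of \<open>B\<close>.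
\<close>

definition locally_trivial :: "('x, 'v) pbundle \<Rightarrow> bool" where
  "locally_trivial B \<longleftrightarrow>
     (\<forall>x\<in>points (base B). \<exists>A. d_open (base B) A \<and> x \<in> A \<and>
        (\<exists>(M :: (real, 'v) module) D \<tau>. diff_vector_space M D \<and>
           diffeomorphism (prod_dspace (sub_dspace (base B) A) D) (sub_dspace (total B) (over B A)) \<tau> \<and>
           (\<forall>a\<in>A. \<forall>e\<in>carrier M. proj B (\<tau> (a, e)) = a) \<and>
           (\<forall>a\<in>A. (\<lambda>e. \<tau> (a, e)) \<in> linear_maps M (fibre B a))))"

text \<open>
  Elements of the dual pseudo-bundle are pairs of a base point and a smooth functional on the fibre
  over it. The condition that \<open>fst \<circ> q\<close> be a plot makes the projection smooth; evaluation on
  plots of \<open>B\<close> alone does not force it.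
\<close>

definition dual_total :: "('x, 'v) pbundle \<Rightarrow> ('x \<times> ('v \<Rightarrow> real)) dspace" where
  "dual_total B =
     \<lparr>points = (SIGMA x:points (base B). carrier (smooth_dual (fibre B x) (fibre_space B x))),
      plots = (\<lambda>n U' q.
        q ` U' \<subseteq> (SIGMA x:points (base B). carrier (smooth_dual (fibre B x) (fibre_space B x))) \<and>
        plots (base B) n U' (fst \<circ> q) \<and>
        (\<forall>m U p. plots (total B) m U p \<longrightarrow>
           smooth_map
             (sub_dspace (prod_dspace (eucl_dspace n U') (eucl_dspace m U))
                {(u', u). fst (q u') = proj B (p u)})
             real_dspace (\<lambda>(u', u). snd (q u') (p u))))\<rparr>"

definition dual_bundle :: "('x, 'v) pbundle \<Rightarrow> ('x, 'x \<times> ('v \<Rightarrow> real)) pbundle" where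
  "dual_bundle B =
     \<lparr>base = base B, total = dual_total B, proj = fst,
      fibre = (\<lambda>x. image_module (Pair x) (smooth_dual (fibre B x) (fibre_space B x)))\<rparr>"

text \<open>
  \<open>tensor_bundle_with B C P\<close> carries the candidate diffeology \<open>P\<close>. The finest admissible
  diffeology is the intersection of all of them.
\<close>

definition tensor_bundle_with ::
  "('x, 'v) pbundle \<Rightarrow> ('x, 'w) pbundle \<Rightarrow>
   (nat \<Rightarrow> (nat \<Rightarrow> real) set \<Rightarrow> ((nat \<Rightarrow> real) \<Rightarrow> 'x \<times> ('v \<times> 'w \<Rightarrow> real) set) \<Rightarrow> bool) \<Rightarrow>
   ('x, 'x \<times> ('v \<times> 'w \<Rightarrow> real) set) pbundle" where
  "tensor_bundle_with B C P =
     \<lparr>base = base B,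
      total = \<lparr>points = (SIGMA x:points (base B). carrier (tensor_module (fibre B x) (fibre C x))),
               plots = P\<rparr>,
      proj = fst,
      fibre = (\<lambda>x. image_module (Pair x) (tensor_module (fibre B x) (fibre C x)))\<rparr>"

definition tensor_map ::
  "('x, 'v) pbundle \<Rightarrow> ('x, 'w) pbundle \<Rightarrow> 'v \<times> 'w \<Rightarrow> 'x \<times> ('v \<times> 'w \<Rightarrow> real) set" where
  "tensor_map B C = (\<lambda>(v, w).
     (proj B v, pure_tensor (fibre B (proj B v)) (fibre C (proj B v)) v w))"

definition tensor_bundle ::
  "('x, 'v) pbundle \<Rightarrow> ('x, 'w) pbundle \<Rightarrow> ('x, 'x \<times> ('v \<times> 'w \<Rightarrow> real) set) pbundle" where
  "tensor_bundle B C = tensor_bundle_with B C (\<lambda>n U p.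
     \<forall>P. pseudo_bundle (tensor_bundle_with B C P) \<and>
         smooth_map (fibre_product B C) (total (tensor_bundle_with B C P)) (tensor_map B C) \<longrightarrow>
         P n U p)"

definition smooth_section :: "('x, 'v) pbundle \<Rightarrow> ('x \<Rightarrow> 'v) \<Rightarrow> bool" where
  "smooth_section B s \<longleftrightarrow>
     smooth_map (base B) (total B) s \<and> (\<forall>x\<in>points (base B). proj B (s x) = x)"

section \<open>Pseudo-metrics\<close>

text \<open>
  The bilinear form given by an element of \<open>E\<^sup>* \<otimes> E\<^sup>*\<close>, computed on any
  representative \<open>c\<close> as \<open>\<Sum> c(\<phi>,\<psi>) \<phi>(v) \<psi>(w)\<close>; the choice of \<open>c\<close> does not matter.
\<close>

definition tensor_form ::
  "('x, 'v) pbundle \<Rightarrow>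
   'x \<times> (('x \<times> ('v \<Rightarrow> real)) \<times> ('x \<times> ('v \<Rightarrow> real)) \<Rightarrow> real) set \<Rightarrow> 'v \<Rightarrow> 'v \<Rightarrow> real" where
  "tensor_form B t v w =
     (let S = carrier (fibre (dual_bundle B) (fst t)) \<times> carrier (fibre (dual_bundle B) (fst t));
          c = (SOME c. c \<in> snd t)
      in \<Sum>p\<in>{p \<in> S. c p \<noteq> 0}. c p * snd (fst p) v * snd (snd p) w)"

text \<open>
  A pseudo-metric is recorded by its forms \<open>g x v w\<close> on the fibres; that \<open>g\<close> is a smooth section
  of the tensor product of the dual with itself means that some smooth section \<open>s\<close> has these forms.
\<close>

definition pseudo_metric :: "('x, 'v) pbundle \<Rightarrow> ('x \<Rightarrow> 'v \<Rightarrow> 'v \<Rightarrow> real) \<Rightarrow> bool" where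
  "pseudo_metric B g \<longleftrightarrow>
     (\<exists>s. smooth_section (tensor_bundle (dual_bundle B) (dual_bundle B)) s \<and>
          (\<forall>x\<in>points (base B). \<forall>v\<in>carrier (fibre B x). \<forall>w\<in>carrier (fibre B x).
             g x v w = tensor_form B (s x) v w)) \<and>
     (\<forall>x\<in>points (base B). vs_pseudo_metric (fibre B x) (fibre_space B x) (g x))"

definition Psi ::
  "('x, 'v) pbundle \<Rightarrow> ('x \<Rightarrow> 'v \<Rightarrow> 'v \<Rightarrow> real) \<Rightarrow> 'v \<Rightarrow> 'x \<times> ('v \<Rightarrow> real)" where
  "Psi B g v = (proj B v, \<lambda>w\<in>carrier (fibre B (proj B v)). g (proj B v) v w)"

definition dual_metric ::
  "('x, 'v) pbundle \<Rightarrow> ('x \<Rightarrow> 'v \<Rightarrow> 'v \<Rightarrow> real) \<Rightarrow>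
   'x \<Rightarrow> 'x \<times> ('v \<Rightarrow> real) \<Rightarrow> 'x \<times> ('v \<Rightarrow> real) \<Rightarrow> real" where
  "dual_metric B g x \<xi> \<eta> =
     (THE r. \<exists>v\<in>carrier (fibre B x). \<exists>w\<in>carrier (fibre B x).
        \<xi> = Psi B g v \<and> \<eta> = Psi B g w \<and> r = g x v w)"

section \<open>Gluing\<close>

definition glue_rel :: "'a dspace \<Rightarrow> 'b dspace \<Rightarrow> 'a set \<Rightarrow> ('a \<Rightarrow> 'b) \<Rightarrow> (('a + 'b) \<times> ('a + 'b)) set" where
  "glue_rel Z1 Z2 Y h =
     {(a, b). a \<in> points (sum_dspace Z1 Z2) \<and> b \<in> points (sum_dspace Z1 Z2) \<and>
        equivclp (\<lambda>c d. \<exists>z\<in>Y. c = Inl z \<and> d = Inr (h z)) a b}"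

definition glue :: "'a dspace \<Rightarrow> 'b dspace \<Rightarrow> 'a set \<Rightarrow> ('a \<Rightarrow> 'b) \<Rightarrow> ('a + 'b) set dspace" where
  "glue Z1 Z2 Y h = quot_dspace (sum_dspace Z1 Z2) (glue_rel Z1 Z2 Y h)"

definition incl1 ::
  "'a dspace \<Rightarrow> 'b dspace \<Rightarrow> 'a set \<Rightarrow> ('a \<Rightarrow> 'b) \<Rightarrow> 'a \<Rightarrow> ('a + 'b) set" where
  "incl1 Z1 Z2 Y h z = glue_rel Z1 Z2 Y h `` {Inl z}"

definition incl2 ::
  "'a dspace \<Rightarrow> 'b dspace \<Rightarrow> 'a set \<Rightarrow> ('a \<Rightarrow> 'b) \<Rightarrow> 'b \<Rightarrow> ('a + 'b) set" where
  "incl2 Z1 Z2 Y h z = glue_rel Z1 Z2 Y h `` {Inr z}"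

text \<open>
  The inverse of the decomposition of a glued space into the disjoint images of \<open>Z1 - Y\<close>
  (under \<^const>\<open>incl1\<close>) and of \<open>Z2\<close> (under \<^const>\<open>incl2\<close>): a class meets \<open>Z2\<close> in at most
  one point, and a class not meeting \<open>Z2\<close> is a single point of \<open>Z1 - Y\<close>.
\<close>

definition unglue :: "('a + 'b) set \<Rightarrow> 'a + 'b" where
  "unglue c = (if \<exists>z. Inr z \<in> c then Inr (THE z. Inr z \<in> c) else Inl (THE z. Inl z \<in> c))"

definition gluing ::
  "('x1, 'v1) pbundle \<Rightarrow> ('x2, 'v2) pbundle \<Rightarrow> 'x1 set \<Rightarrow> ('v1 \<Rightarrow> 'v2) \<Rightarrow> ('x1 \<Rightarrow> 'x2) \<Rightarrow> bool" where
  "gluing B1 B2 Y ft f \<longleftrightarrow>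
     Y \<subseteq> points (base B1) \<and>
     smooth_map (sub_dspace (base B1) Y) (base B2) f \<and>
     smooth_map (sub_dspace (total B1) (over B1 Y)) (total B2) ft \<and>
     (\<forall>v\<in>over B1 Y. proj B2 (ft v) = f (proj B1 v)) \<and>
     (\<forall>y\<in>Y. ft \<in> linear_maps (fibre B1 y) (fibre B2 (f y)))"

abbreviation base_incl1 ::
  "('x1, 'v1) pbundle \<Rightarrow> ('x2, 'v2) pbundle \<Rightarrow> 'x1 set \<Rightarrow> ('x1 \<Rightarrow> 'x2) \<Rightarrow> 'x1 \<Rightarrow> ('x1 + 'x2) set" where
  "base_incl1 B1 B2 Y f \<equiv> incl1 (base B1) (base B2) Y f"

abbreviation base_incl2 ::
  "('x1, 'v1) pbundle \<Rightarrow> ('x2, 'v2) pbundle \<Rightarrow> 'x1 set \<Rightarrow> ('x1 \<Rightarrow> 'x2) \<Rightarrow> 'x2 \<Rightarrow> ('x1 + 'x2) set" where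
  "base_incl2 B1 B2 Y f \<equiv> incl2 (base B1) (base B2) Y f"

abbreviation total_incl1 ::
  "('x1, 'v1) pbundle \<Rightarrow> ('x2, 'v2) pbundle \<Rightarrow> 'x1 set \<Rightarrow> ('v1 \<Rightarrow> 'v2) \<Rightarrow> 'v1 \<Rightarrow> ('v1 + 'v2) set" where
  "total_incl1 B1 B2 Y ft \<equiv> incl1 (total B1) (total B2) (over B1 Y) ft"

abbreviation total_incl2 ::
  "('x1, 'v1) pbundle \<Rightarrow> ('x2, 'v2) pbundle \<Rightarrow> 'x1 set \<Rightarrow> ('v1 \<Rightarrow> 'v2) \<Rightarrow> 'v2 \<Rightarrow> ('v1 + 'v2) set" where
  "total_incl2 B1 B2 Y ft \<equiv> incl2 (total B1) (total B2) (over B1 Y) ft"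

definition glue_bundle ::
  "('x1, 'v1) pbundle \<Rightarrow> ('x2, 'v2) pbundle \<Rightarrow> 'x1 set \<Rightarrow> ('v1 \<Rightarrow> 'v2) \<Rightarrow> ('x1 \<Rightarrow> 'x2) \<Rightarrow>
   (('x1 + 'x2) set, ('v1 + 'v2) set) pbundle" where
  "glue_bundle B1 B2 Y ft f =
     \<lparr>base = glue (base B1) (base B2) Y f,
      total = glue (total B1) (total B2) (over B1 Y) ft,
      proj = (\<lambda>c. case unglue c of
          Inl v \<Rightarrow> base_incl1 B1 B2 Y f (proj B1 v)
        | Inr v \<Rightarrow> base_incl2 B1 B2 Y f (proj B2 v)),
      fibre = (\<lambda>c. case unglue c of
          Inl x \<Rightarrow> image_module (total_incl1 B1 B2 Y ft) (fibre B1 x)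
        | Inr x \<Rightarrow> image_module (total_incl2 B1 B2 Y ft) (fibre B2 x))\<rparr>"

definition compatible ::
  "('x1, 'v1) pbundle \<Rightarrow> 'x1 set \<Rightarrow> ('v1 \<Rightarrow> 'v2) \<Rightarrow> ('x1 \<Rightarrow> 'x2) \<Rightarrow>
   ('x1 \<Rightarrow> 'v1 \<Rightarrow> 'v1 \<Rightarrow> real) \<Rightarrow> ('x2 \<Rightarrow> 'v2 \<Rightarrow> 'v2 \<Rightarrow> real) \<Rightarrow> bool" where
  "compatible B1 Y ft f g1 g2 \<longleftrightarrow>
     (\<forall>y\<in>Y. \<forall>v\<in>carrier (fibre B1 y). \<forall>w\<in>carrier (fibre B1 y).
        g1 y v w = g2 (f y) (ft v) (ft w))"

text \<open>
  On a fibre of the glued bundle the form is \<open>g1\<close> over the image of \<open>X1 - Y\<close> and \<open>g2\<close> over the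
  image of \<open>X2\<close>.
\<close>

definition glue_metric ::
  "('x1, 'v1) pbundle \<Rightarrow> ('x2, 'v2) pbundle \<Rightarrow> 'x1 set \<Rightarrow> ('v1 \<Rightarrow> 'v2) \<Rightarrow>
   ('x1 \<Rightarrow> 'v1 \<Rightarrow> 'v1 \<Rightarrow> real) \<Rightarrow> ('x2 \<Rightarrow> 'v2 \<Rightarrow> 'v2 \<Rightarrow> real) \<Rightarrow>
   ('x1 + 'x2) set \<Rightarrow> ('v1 + 'v2) set \<Rightarrow> ('v1 + 'v2) set \<Rightarrow> real" where
  "glue_metric B1 B2 Y ft g1 g2 c a b =
     (case unglue c of
        Inl x \<Rightarrow> (let k = inv_into (carrier (fibre B1 x)) (total_incl1 B1 B2 Y ft) in g1 x (k a) (k b))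
      | Inr x \<Rightarrow> (let k = inv_into (carrier (fibre B2 x)) (total_incl2 B1 B2 Y ft) in g2 x (k a) (k b)))"

text \<open>The map \<open>\<xi> \<mapsto> \<xi> \<circ> ft\<close> from the dual of \<open>B2\<close> over \<open>f ` Y\<close> to the dual of \<open>B1\<close>.\<close>

definition dual_lift ::
  "('x1, 'v1) pbundle \<Rightarrow> 'x1 set \<Rightarrow> ('v1 \<Rightarrow> 'v2) \<Rightarrow> ('x1 \<Rightarrow> 'x2) \<Rightarrow>
   'x2 \<times> ('v2 \<Rightarrow> real) \<Rightarrow> 'x1 \<times> ('v1 \<Rightarrow> real)" where
  "dual_lift B1 Y ft f = (\<lambda>(x, \<xi>).
     let y = inv_into Y f x in (y, \<lambda>v\<in>carrier (fibre B1 y). \<xi> (ft v)))"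

definition dual_glue_bundle ::
  "('x1, 'v1) pbundle \<Rightarrow> ('x2, 'v2) pbundle \<Rightarrow> 'x1 set \<Rightarrow> ('v1 \<Rightarrow> 'v2) \<Rightarrow> ('x1 \<Rightarrow> 'x2) \<Rightarrow>
   (('x2 + 'x1) set, ('x2 \<times> ('v2 \<Rightarrow> real) + 'x1 \<times> ('v1 \<Rightarrow> real)) set) pbundle" where
  "dual_glue_bundle B1 B2 Y ft f =
     glue_bundle (dual_bundle B2) (dual_bundle B1) (f ` Y) (dual_lift B1 Y ft f) (inv_into Y f)"

definition dual_glue_metric ::
  "('x1, 'v1) pbundle \<Rightarrow> ('x2, 'v2) pbundle \<Rightarrow> 'x1 set \<Rightarrow> ('v1 \<Rightarrow> 'v2) \<Rightarrow> ('x1 \<Rightarrow> 'x2) \<Rightarrow>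
   ('x1 \<Rightarrow> 'v1 \<Rightarrow> 'v1 \<Rightarrow> real) \<Rightarrow> ('x2 \<Rightarrow> 'v2 \<Rightarrow> 'v2 \<Rightarrow> real) \<Rightarrow> ('x2 + 'x1) set \<Rightarrow>
   ('x2 \<times> ('v2 \<Rightarrow> real) + 'x1 \<times> ('v1 \<Rightarrow> real)) set \<Rightarrow>
   ('x2 \<times> ('v2 \<Rightarrow> real) + 'x1 \<times> ('v1 \<Rightarrow> real)) set \<Rightarrow> real" where
  "dual_glue_metric B1 B2 Y ft f g1 g2 =
     glue_metric (dual_bundle B2) (dual_bundle B1) (f ` Y) (dual_lift B1 Y ft f)
       (dual_metric B2 g2) (dual_metric B1 g1)"

definition switch_map ::
  "('x1, 'v1) pbundle \<Rightarrow> ('x2, 'v2) pbundle \<Rightarrow> 'x1 set \<Rightarrow> ('x1 \<Rightarrow> 'x2) \<Rightarrow>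
   ('x1 + 'x2) set \<Rightarrow> ('x2 + 'x1) set" where
  "switch_map B1 B2 Y f c =
     (case unglue c of
        Inl x \<Rightarrow> base_incl2 B2 B1 (f ` Y) (inv_into Y f) x
      | Inr x \<Rightarrow> if x \<in> f ` Y then base_incl2 B2 B1 (f ` Y) (inv_into Y f) (inv_into Y f x)
                 else base_incl1 B2 B1 (f ` Y) (inv_into Y f) x)"

definition Phi_dual ::
  "('x1, 'v1) pbundle \<Rightarrow> ('x2, 'v2) pbundle \<Rightarrow> 'x1 set \<Rightarrow> ('v1 \<Rightarrow> 'v2) \<Rightarrow> ('x1 \<Rightarrow> 'x2) \<Rightarrow>
   ('x1 + 'x2) set \<times> (('v1 + 'v2) set \<Rightarrow> real) \<Rightarrow>
   ('x2 \<times> ('v2 \<Rightarrow> real) + 'x1 \<times> ('v1 \<Rightarrow> real)) set" where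
  "Phi_dual B1 B2 Y ft f = (\<lambda>(c, \<eta>).
     let j1 = total_incl1 B1 B2 Y ft;
         j2 = total_incl2 B1 B2 Y ft;
         k1 = total_incl1 (dual_bundle B2) (dual_bundle B1) (f ` Y) (dual_lift B1 Y ft f);
         k2 = total_incl2 (dual_bundle B2) (dual_bundle B1) (f ` Y) (dual_lift B1 Y ft f)
     in case unglue c of
          Inl x \<Rightarrow> k2 (x, \<lambda>v\<in>carrier (fibre B1 x). \<eta> (j1 v))
        | Inr x \<Rightarrow>
            let \<xi> = (x, \<lambda>v\<in>carrier (fibre B2 x). \<eta> (j2 v))
            in if x \<in> f ` Y then k2 (dual_lift B1 Y ft f \<xi>) else k1 \<xi>)"

definition Phi_dual_inv ::
  "('x1, 'v1) pbundle \<Rightarrow> ('x2, 'v2) pbundle \<Rightarrow> 'x1 set \<Rightarrow> ('v1 \<Rightarrow> 'v2) \<Rightarrow> ('x1 \<Rightarrow> 'x2) \<Rightarrow>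
   ('x2 \<times> ('v2 \<Rightarrow> real) + 'x1 \<times> ('v1 \<Rightarrow> real)) set \<Rightarrow>
   ('x1 + 'x2) set \<times> (('v1 + 'v2) set \<Rightarrow> real)" where
  "Phi_dual_inv B1 B2 Y ft f =
     inv_into (points (total (dual_bundle (glue_bundle B1 B2 Y ft f)))) (Phi_dual B1 B2 Y ft f)"

end

theory Submission
  imports Defs
begin

text \<open>
  On a fibre of the glued bundle over a point of \<open>X\<^sub>1 - Y\<close> or \<open>X\<^sub>2\<close>, the inclusion of the
  corresponding fibre of \<open>V\<^sub>1\<close> or \<open>V\<^sub>2\<close> is a diffeomorphism, so pulling back along it identifies
  the smooth duals and the dual forms. Off \<open>f(Y)\<close> the map \<open>\<Phi>\<close> is this identification and nothing
  more happens. Over \<open>f(y)\<close>, \<open>\<Phi>\<close> also applies \<open>ft\<^sup>*\<close>, and one has to compare the dual of \<open>g\<^sub>2\<close>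
  at \<open>f(y)\<close> with the dual of \<open>g\<^sub>1\<close> at \<open>y\<close>. Compatibility says \<open>ft\<^sup>*(\<Psi>\<^sub>2(ft v)) = \<Psi>\<^sub>1(v)\<close>. The rank
  condition and finite dimension make \<open>\<Psi>\<^sub>1\<close> surjective, and \<open>ft\<^sup>*\<close> is injective, so \<open>ft\<^sup>*\<close> is bijective
  between the two dual fibres and every functional at \<open>f(y)\<close> is some \<open>\<Psi>\<^sub>2(ft v)\<close>; on these
  \<open>g\<^sub>2(ft v, ft w) = g\<^sub>1(v, w)\<close>.
\<close>

section \<open>Smooth functions\<close>

text \<open>Pasting over all open subsets of \<open>U\<close> on which \<open>f\<close> is
  continuous: every piece is \<open>f\<close> itself, so agreement on overlaps is automatic.\<close>

lemma continuous_map_local: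
  assumes U: "openin X U"
    and loc: "\<And>u. u \<in> U \<Longrightarrow> \<exists>W. openin X W \<and> u \<in> W \<and> W \<subseteq> U \<and> continuous_map (subtopology X W) Y f"
  shows "continuous_map (subtopology X U) Y f"
proof (rule pasting_lemma[where I = "{W. openin X W \<and> W \<subseteq> U \<and> continuous_map (subtopology X W) Y f}"
      and T = "\<lambda>W. W" and f = "\<lambda>_. f"])
  show "openin (subtopology X U) W"
    if "W \<in> {W. openin X W \<and> W \<subseteq> U \<and> continuous_map (subtopology X W) Y f}" for W
    using that U by (auto simp: openin_open_subtopology)
  show "continuous_map (subtopology (subtopology X U) W) Y f"
    if "W \<in> {W. openin X W \<and> W \<subseteq> U \<and> continuous_map (subtopology X W) Y f}" for W
    using that by (auto simp: subtopology_subtopology Int_absorb1)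
  show "\<exists>W. W \<in> {W. openin X W \<and> W \<subseteq> U \<and> continuous_map (subtopology X W) Y f} \<and> x \<in> W \<and> f x = f x"
    if "x \<in> topspace (subtopology X U)" for x
    using loc[of x] that by auto
qed auto

text \<open>Because \<open>i < n\<close>, changing coordinate \<open>i\<close> stays inside
  \<open>Euclidean_space n\<close>, so the slice is continuous into it and the preimage of
  \<open>U\<close> is open. A partial derivative at a point of \<open>U\<close> thus depends only on
  values in \<open>U\<close>.\<close>

lemma eventually_slice_in_openin:
  assumes U: "openin (Euclidean_space n) U" and x: "x \<in> U" and i: "i < n"
  shows "\<forall>\<^sub>F t in nhds (x i). x(i := t) \<in> U"
proof -
  have xs: "\<forall>j\<ge>n. x j = 0"
    using openin_subset[OF U] x by (auto simp: topspace_Euclidean_space)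
  have "continuous_map euclideanreal (powertop_real UNIV) (\<lambda>t. x(i := t))"
    unfolding continuous_map_componentwise_UNIV by (auto simp: fun_upd_def)
  then have "continuous_map euclideanreal (Euclidean_space n) (\<lambda>t. x(i := t))"
    unfolding Euclidean_space_def continuous_map_in_subtopology using xs i by auto
  then have "open {t. x(i := t) \<in> U}"
    using openin_continuous_map_preimage[OF _ U] by fastforce
  moreover have "x(i := x i) \<in> U" using x by simp
  ultimately show ?thesis
    unfolding eventually_nhds by blast
qed

text \<open>Slices through a point of \<open>U\<close> agree near that point, hence have the same
  derivatives, and the partial derivatives agree on \<open>U\<close> again. The induction therefore
  runs over arbitrary pairs \<open>f\<close>, \<open>g\<close>.\<close>

lemma Ck_on_cong:
  assumes "openin (Euclidean_space n) U" "\<And>x. x \<in> U \<Longrightarrow> f x = g x" "Ck_on n k U f"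
  shows "Ck_on n k U g"
  using assms(2,3)
proof (induction k arbitrary: f g)
  case 0
  then show ?case by (auto intro: continuous_map_eq[where f = f])
next
  case (Suc k)
  have cont: "continuous_map (subtopology (Euclidean_space n) U) euclideanreal g"
    using Suc.prems by (auto intro: continuous_map_eq[where f = f])
  have ev: "\<forall>\<^sub>F t in nhds (x i). f (x(i := t)) = g (x(i := t))" if "x \<in> U" "i < n" for x i
    using eventually_slice_in_openin[OF assms(1) that]
    by (rule eventually_mono) (rule Suc.prems(1))
  have diff: "(\<lambda>t. g (x(i := t))) field_differentiable at (x i)" if "x \<in> U" "i < n" for x i
  proof -
    have "(\<lambda>t. f (x(i := t))) field_differentiable at (x i)"
      using Suc.prems(2) that by simp
    then show ?thesis
      unfolding field_differentiable_def DERIV_cong_ev[OF refl ev[OF that] refl] .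
  qed
  have "Ck_on n k U (partial_deriv i g)" if "i < n" for i
  proof (rule Suc.IH)
    show "Ck_on n k U (partial_deriv i f)" using Suc.prems(2) that by simp
    show "partial_deriv i f x = partial_deriv i g x" if "x \<in> U" for x
      unfolding partial_deriv_def using ev[OF that \<open>i < n\<close>] by (rule deriv_cong_ev) simp
  qed
  then show ?case using cont diff by simp
qed

text \<open>Differentiability and \<open>partial_deriv\<close> at a point do not refer to the open
  set, so only continuity requires patching; the induction then passes to the partial
  derivatives.\<close>

lemma Ck_on_local:
  assumes U: "openin (Euclidean_space n) U"
    and loc: "\<And>u. u \<in> U \<Longrightarrow> \<exists>W. openin (Euclidean_space n) W \<and> u \<in> W \<and> W \<subseteq> U \<and> Ck_on n k W f"
  shows "Ck_on n k U f"
  using loc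
proof (induction k arbitrary: f)
  case (0 f)
  have *: "\<exists>W. openin (Euclidean_space n) W \<and> u \<in> W \<and> W \<subseteq> U \<and>
      continuous_map (subtopology (Euclidean_space n) W) euclideanreal f" if "u \<in> U" for u
    using 0[OF that] by simp
  show ?case
    using continuous_map_local[of "Euclidean_space n" U euclideanreal f, OF U *] by simp
next
  case (Suc k f)
  have "\<exists>W. openin (Euclidean_space n) W \<and> u \<in> W \<and> W \<subseteq> U \<and> Ck_on n 0 W f" if "u \<in> U" for u
    using Suc.prems[OF that] by auto
  then have "continuous_map (subtopology (Euclidean_space n) U) euclideanreal f"
    by (intro continuous_map_local[OF U]) simp
  moreover have "(\<lambda>t. f (x(i := t))) field_differentiable at (x i)" if "x \<in> U" "i < n" for x i
    using Suc.prems[OF that(1)] that by auto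
  moreover have "Ck_on n k U (partial_deriv i f)" if "i < n" for i
  proof (rule Suc.IH)
    fix u assume "u \<in> U"
    then show "\<exists>W. openin (Euclidean_space n) W \<and> u \<in> W \<and> W \<subseteq> U \<and> Ck_on n k W (partial_deriv i f)"
      using Suc.prems[of u] that by auto
  qed
  ultimately show ?case by simp
qed

lemma smooth_fun_cong:
  assumes "smooth_fun n U f" "\<And>x. x \<in> U \<Longrightarrow> f x = g x"
  shows "smooth_fun n U g"
  using assms Ck_on_cong[of n U f g] unfolding smooth_fun_def by auto

lemma smooth_fun_local:
  assumes "openin (Euclidean_space n) U"
    and "\<And>u. u \<in> U \<Longrightarrow> \<exists>W. u \<in> W \<and> W \<subseteq> U \<and> smooth_fun n W f"
  shows "smooth_fun n U f"
  unfolding smooth_fun_def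
proof (intro conjI allI)
  show "openin (Euclidean_space n) U" by fact
  show "Ck_on n k U f" for k
    by (rule Ck_on_local[OF assms(1)]) (use assms(2) smooth_fun_def in metis)
qed

section \<open>Linear combinations of smooth functions\<close>

lemma Ck_on_const: "Ck_on n k U (\<lambda>_. c)"
proof (induction k arbitrary: c)
  case (Suc k)
  have "partial_deriv i (\<lambda>_. c) = (\<lambda>_. 0)" for i
    by (simp add: partial_deriv_def fun_eq_iff)
  then show ?case using Suc by simp
qed simp

text \<open>Linearity of the derivative is available only at points of \<open>U\<close>, where
  \<open>f\<close> and \<open>g\<close> are differentiable; \<open>Ck_on_cong\<close> carries the
  formula over to \<open>partial_deriv i ?h\<close>.\<close>

lemma Ck_on_lincomb:
  assumes U: "openin (Euclidean_space n) U" and "Ck_on n k U f" "Ck_on n k U g"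
  shows "Ck_on n k U (\<lambda>x. a * f x + b * g x)"
  using assms(2,3)
proof (induction k arbitrary: f g)
  case 0
  then show ?case by (auto intro!: continuous_intros)
next
  case (Suc k)
  let ?h = "\<lambda>x. a * f x + b * g x"
  have fd: "(\<lambda>t. f (x(i := t))) field_differentiable (at (x i))"
    and gd: "(\<lambda>t. g (x(i := t))) field_differentiable (at (x i))" if "x \<in> U" "i < n" for x i
    using Suc.prems that by simp_all
  have cont: "continuous_map (subtopology (Euclidean_space n) U) euclideanreal ?h"
    using Suc.prems by (auto intro!: continuous_intros)
  have diff: "(\<lambda>t. ?h (x(i := t))) field_differentiable (at (x i))" if "x \<in> U" "i < n" for x i
    by (intro derivative_intros fd gd that)
  have pd: "Ck_on n k U (partial_deriv i ?h)" if "i < n" for i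
  proof (rule Ck_on_cong[OF U])
    show "Ck_on n k U (\<lambda>x. a * partial_deriv i f x + b * partial_deriv i g x)"
      using Suc.prems that by (intro Suc.IH) simp_all
    show "a * partial_deriv i f x + b * partial_deriv i g x = partial_deriv i ?h x" if "x \<in> U" for x
      using fd[OF that \<open>i < n\<close>] gd[OF that \<open>i < n\<close>]
      unfolding partial_deriv_def by (simp add: field_differentiable_mult field_differentiable_const)
  qed
  show ?case using cont diff pd by simp
qed

lemma smooth_fun_zero: "openin (Euclidean_space n) U \<Longrightarrow> smooth_fun n U (\<lambda>_. 0)"
  by (simp add: smooth_fun_def Ck_on_const)

lemma smooth_fun_lincomb:
  "smooth_fun n U f \<Longrightarrow> smooth_fun n U g \<Longrightarrow> smooth_fun n U (\<lambda>x. a * f x + b * g x)"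
  by (auto simp: smooth_fun_def intro: Ck_on_lincomb)

section \<open>Finite-dimensional subspaces\<close>

text \<open>Independent subsets of \<open>W\<close> are independent in \<open>V\<close>, so their
  sizes are bounded by \<open>dim\<close>; one that is maximal under inclusion then exists, is
  finite and generates \<open>W\<close>.\<close>

lemma (in vectorspace) fin_dim_subspace:
  assumes fd: "fin_dim" and W: "subspace K W V"
  shows "vectorspace.fin_dim K (vs W)"
proof -
  interpret W: vectorspace K "vs W" using W by (rule subspace_is_vs)
  have sub: "submodule K W V" using W by simp
  have WV: "W \<subseteq> carrier V" using sub by (simp add: submodule_def)
  have li: "W.lin_indpt A \<longleftrightarrow> lin_indpt A" if "A \<subseteq> W" for A
    using span_li_not_depend(2)[OF that sub] by simp
  obtain A where A: "finite A" "maximal A (\<lambda>S. S \<subseteq> carrier (vs W) \<and> W.lin_indpt S)"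
  proof -
    have "\<exists>A. finite A \<and> maximal A (\<lambda>S. S \<subseteq> carrier (vs W) \<and> W.lin_indpt S)"
    proof (rule maximal_exists)
      show "finite A \<and> card A \<le> dim" if "A \<subseteq> carrier (vs W) \<and> W.lin_indpt A" for A
        using li_le_dim[OF fd, of A] that WV li by auto
      show "{} \<subseteq> carrier (vs W) \<and> W.lin_indpt {}"
        by (auto simp: W.lin_dep_def)
    qed
    then show thesis using that by blast
  qed
  then show ?thesis
    using W.max_li_is_gen[OF A(2)] unfolding W.fin_dim_def maximal_def by auto
qed

text \<open>The image is finite-dimensional as a subspace of \<open>W\<close>, and the inverse of
  \<open>T\<close> maps it linearly onto \<open>V\<close>.\<close>

lemma (in linear_map) fin_dim_of_inj:
  assumes inj: "inj_on T (carrier V)" and fd: "W.fin_dim"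
  shows "V.fin_dim"
proof -
  interpret im: vectorspace K "W.vs imT"
    using imT_is_subspace by (rule W.subspace_is_vs)
  have fd_im: "im.fin_dim" using W.fin_dim_subspace[OF fd imT_is_subspace] .
  let ?S = "inv_into (carrier V) T"
  have S: "?S (T v) = v" if "v \<in> carrier V" for v using inj that by simp
  have "?S \<in> module_hom K (W.vs imT) V"
  proof -
    have "?S (T v \<oplus>\<^bsub>W\<^esub> T v') = v \<oplus>\<^bsub>V\<^esub> v'" if "v \<in> carrier V" "v' \<in> carrier V" for v v'
      using S[of "v \<oplus>\<^bsub>V\<^esub> v'"] that by simp
    moreover have "?S (r \<odot>\<^bsub>W\<^esub> T v) = r \<odot>\<^bsub>V\<^esub> v" if "r \<in> carrier K" "v \<in> carrier V" for r v
      using S[of "r \<odot>\<^bsub>V\<^esub> v"] that by simp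
    ultimately show ?thesis
      unfolding module_hom_def im_def using S by auto
  qed
  then interpret S: linear_map K "W.vs imT" V ?S
    by unfold_locales
  have "?S ` carrier (W.vs imT) = carrier V"
    using S by (force simp: im_def image_image)
  then show ?thesis using S.image_fin_dim[OF fd_im] by simp
qed

text \<open>A basis of \<open>W\<close> is an independent set in \<open>V\<close> with
  \<open>dim\<close> elements, hence a basis of \<open>V\<close>, and the two spans
  coincide.\<close>

lemma (in vectorspace) subspace_eqI_dim:
  assumes fd: "fin_dim" and W: "subspace K W V"
    and d: "vectorspace.dim K (vs W) = dim"
  shows "W = carrier V"
proof -
  interpret W: vectorspace K "vs W" using W by (rule subspace_is_vs)
  have sub: "submodule K W V" using W by simp
  have WV: "W \<subseteq> carrier V" using sub by (simp add: submodule_def)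
  obtain B where B: "finite B" "W.basis B"
    using W.finite_basis_exists fin_dim_subspace[OF fd W] by auto
  then have BW: "B \<subseteq> W" and li: "lin_indpt B" and card: "card B = dim" and gen: "W.span B = W"
    using W.dim_basis[OF B] d span_li_not_depend(2)[OF _ sub, of B] by (auto simp: W.basis_def)
  have "basis B"
    using dim_li_is_basis[OF fd B(1) _ li] BW WV card by auto
  then show ?thesis
    using gen span_li_not_depend(1)[OF BW sub] by (simp add: basis_def)
qed

section \<open>Linear functionals on a finite-dimensional space\<close>

lemma vectorspace_fun_module: "real_vectorspace (fun_module S)"
proof -
  \<comment> \<open>The interpretation provides \<open>class_ring\<close> as a field; dimension 0 is
    an arbitrary choice.\<close>
  interpret vec_space "TYPE(real)" 0 .
  show ?thesis by (rule func_space_is_vs)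
qed

lemma fun_module_simps:
  "carrier (fun_module S) = S \<rightarrow>\<^sub>E UNIV"
  "\<zero>\<^bsub>fun_module S\<^esub> = (\<lambda>s\<in>S. 0)"
  "\<phi> \<oplus>\<^bsub>fun_module S\<^esub> \<psi> = (\<lambda>s\<in>S. \<phi> s + \<psi> s)"
  "r \<odot>\<^bsub>fun_module S\<^esub> \<phi> = (\<lambda>s\<in>S. r * \<phi> s)"
  by (simp_all add: LinearCombinations.ring.func_space_def[OF class_ring.ring_axioms])

lemma linear_maps_real_iff:
  "\<phi> \<in> linear_maps M real_module \<longleftrightarrow>
     (\<forall>v\<in>carrier M. \<forall>w\<in>carrier M. \<phi> (v \<oplus>\<^bsub>M\<^esub> w) = \<phi> v + \<phi> w) \<and>
     (\<forall>r. \<forall>v\<in>carrier M. \<phi> (r \<odot>\<^bsub>M\<^esub> v) = r * \<phi> v)"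
  by (auto simp: module_hom_def real_module_def )

text \<open>A linear functional is determined by its values on a finite generating set, so
  evaluation at \<open>n\<close> generators embeds \<open>L\<close> in real
  \<open>n\<close>-space.\<close>

lemma fin_dim_linear_functionals:
  assumes M: "real_vectorspace M" and fd: "vectorspace.fin_dim class_ring M"
    and L: "subspace class_ring L (fun_module (carrier M))"
    and lin: "L \<subseteq> linear_maps M real_module"
  shows "vectorspace.fin_dim class_ring ((fun_module (carrier M))\<lparr>carrier := L\<rparr>)"
proof -
  interpret M: vectorspace "class_ring :: real ring" M by fact
  interpret F: vectorspace "class_ring :: real ring" "fun_module (carrier M)"
    by (rule vectorspace_fun_module)
  interpret L: vectorspace "class_ring :: real ring" "F.vs L"
    using L by (rule F.subspace_is_vs)
  have sub: "submodule class_ring L (fun_module (carrier M))" using L by simp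
  have LF: "L \<subseteq> carrier M \<rightarrow>\<^sub>E UNIV"
    using sub by (auto simp: submodule_def fun_module_simps )
  obtain B where B: "finite B" "B \<subseteq> carrier M" "M.gen_set B"
    using fd unfolding M.fin_dim_def by auto
  obtain bs where bs: "set bs = B" using B(1) finite_list by auto
  define n where "n = length bs"
  interpret R: vec_space "TYPE(real)" n .
  define T where "T = (\<lambda>\<phi>. vec n (\<lambda>i. \<phi> (bs ! i)) :: real vec)"
  have bsM: "bs ! i \<in> carrier M" if "i < n" for i
    using that B(2) bs unfolding n_def by auto
  have "T \<in> module_hom class_ring (F.vs L) (module_vec TYPE(real) n)"
    using bsM by (auto simp: module_hom_def T_def fun_module_simps module_vec_simps)
  then interpret T: linear_map "class_ring :: real ring" "F.vs L" "module_vec TYPE(real) n" T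
    by unfold_locales
  have "inj_on T (carrier (F.vs L))"
  proof (rule inj_onI)
    fix \<phi> \<psi> assume "\<phi> \<in> carrier (F.vs L)" "\<psi> \<in> carrier (F.vs L)" and eq: "T \<phi> = T \<psi>"
    then have L': "\<phi> \<in> L" "\<psi> \<in> L" by auto
    have \<phi>: "\<phi> \<in> linear_maps M real_module" and \<psi>: "\<psi> \<in> linear_maps M real_module"
      using L' lin by auto
    have z: "\<alpha> \<zero>\<^bsub>M\<^esub> = 0" if "\<alpha> \<in> linear_maps M real_module" for \<alpha>
    proof -
      have "\<alpha> (\<zero>\<^bsub>M\<^esub> \<oplus>\<^bsub>M\<^esub> \<zero>\<^bsub>M\<^esub>) = \<alpha> \<zero>\<^bsub>M\<^esub> + \<alpha> \<zero>\<^bsub>M\<^esub>"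
        using that M.M.zero_closed unfolding linear_maps_real_iff by blast
      then show ?thesis by simp
    qed
    \<comment> \<open>The agreement set of two functionals is a submodule; it contains the
      generators, hence is everything.\<close>
    let ?N = "{v \<in> carrier M. \<phi> v = \<psi> v}"
    have "submodule class_ring ?N M"
      using \<phi> \<psi> z[OF \<phi>] z[OF \<psi>] M.module_axioms
      unfolding submodule_def linear_maps_real_iff by (auto simp: )
    moreover have "B \<subseteq> ?N"
    proof
      fix b assume "b \<in> B"
      then obtain i where i: "i < n" "b = bs ! i"
        using bs unfolding n_def by (auto simp: in_set_conv_nth)
      have "vec_index (T \<phi>) i = vec_index (T \<psi>) i" using eq by simp
      then show "b \<in> ?N" using i bsM by (simp add: T_def)
    qed
    ultimately have "carrier M \<subseteq> ?N"
      using M.span_is_subset B(3) by blast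
    then show "\<phi> = \<psi>"
      using L' LF by (intro extensionalityI[where A = "carrier M"]) (auto simp: PiE_def)
  qed
  then show ?thesis using T.fin_dim_of_inj by simp
qed

section \<open>Smooth duals and dual metrics\<close>

lemma diffeological_space_plotD:
  assumes "diffeological_space X" "plots X n U p"
  shows "openin (Euclidean_space n) U" "p ` U \<subseteq> points X"
  using assms unfolding diffeological_space_def by meson+

lemma diffeological_space_const:
  assumes "diffeological_space X" "openin (Euclidean_space n) U" "x \<in> points X"
  shows "plots X n U (\<lambda>_. x)"
  using assms unfolding diffeological_space_def by meson

lemma diffeological_space_sub:
  assumes "diffeological_space X"
  shows "diffeological_space (sub_dspace X A)"
proof -
  note D = assms[unfolded diffeological_space_def]
  have 1: "openin (Euclidean_space n) U \<and> p ` U \<subseteq> points X" if "plots X n U p" for n U p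
    using D[THEN conjunct1] that by blast
  have 2: "plots X n U q" if "plots X n U p" "\<forall>u\<in>U. p u = q u" for n U p q
    using D[THEN conjunct2, THEN conjunct1] that by blast
  have 3: "plots X n U (\<lambda>_. x)" if "x \<in> points X" "openin (Euclidean_space n) U" for n U x
    using D[THEN conjunct2, THEN conjunct2, THEN conjunct1] that by blast
  have 4: "plots X n U p" if "openin (Euclidean_space n) U"
    "\<forall>u\<in>U. \<exists>W. openin (Euclidean_space n) W \<and> u \<in> W \<and> W \<subseteq> U \<and> plots X n W p" for n U p
    using D[THEN conjunct2, THEN conjunct2, THEN conjunct2, THEN conjunct1, rule_format, OF that(1)] that(2) by blast
  have 5: "plots X m W (p \<circ> F)" if "plots X n U p" "smooth_param m W n U F" for n U p m W F
    using D[THEN conjunct2, THEN conjunct2, THEN conjunct2, THEN conjunct2] that by blast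
  show ?thesis
    unfolding diffeological_space_def sub_dspace_def dspace.simps
  proof (intro conjI allI impI ballI)
    fix n U p assume "openin (Euclidean_space n) U"
      "\<forall>u\<in>U. \<exists>W. openin (Euclidean_space n) W \<and> u \<in> W \<and> W \<subseteq> U \<and> plots X n W p \<and> p ` W \<subseteq> A"
    then show "plots X n U p" "p ` U \<subseteq> A" using 4[of n U p] by blast+
  next
    fix n U p m W F
    assume "plots X n U p \<and> p ` U \<subseteq> A" "smooth_param m W n U F"
    then show "plots X m W (p \<circ> F)" "(p \<circ> F) ` W \<subseteq> A"
      using 5 by (auto simp: smooth_param_def image_subset_iff)
  next
    fix n U p q
    assume "plots X n U p \<and> p ` U \<subseteq> A" "\<forall>u\<in>U. p u = q u"
    then show "plots X n U q" "q ` U \<subseteq> A"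
      using 2 by (auto simp: image_subset_iff)
  qed (use 1 3 in \<open>fastforce+\<close>)
qed

lemma smooth_map_real_iff:
  "smooth_map X real_dspace \<phi> \<longleftrightarrow> (\<forall>n U p. plots X n U p \<longrightarrow> smooth_fun n U (\<phi> \<circ> p))"
  by (simp add: smooth_map_def real_dspace_def)

lemma mem_smooth_dual_iff:
  "\<phi> \<in> carrier (smooth_dual M D) \<longleftrightarrow>
     \<phi> \<in> extensional (carrier M) \<and> \<phi> \<in> linear_maps M real_module \<and> smooth_map D real_dspace \<phi>"
  by (simp add: smooth_dual_def)

text \<open>Closure is checked on plots, whose values lie in \<open>carrier M\<close>, so the
  restriction built into the operations of \<open>fun_module\<close> is invisible there.\<close>

lemma submodule_smooth_dual:
  assumes M: "real_vectorspace M" and D: "diffeological_space D" "points D = carrier M"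
  shows "submodule class_ring (carrier (smooth_dual M D)) (fun_module (carrier M))"
proof -
  interpret M: vectorspace "class_ring :: real ring" M by fact
  interpret F: vectorspace "class_ring :: real ring" "fun_module (carrier M)"
    by (rule vectorspace_fun_module)
  \<comment> \<open>One combination covers both sums (\<open>a = b = 1\<close>) and scalar multiples
    (\<open>b = 0\<close>).\<close>
  have comb: "(\<lambda>v\<in>carrier M. a * \<phi> v + b * \<psi> v) \<in> carrier (smooth_dual M D)"
    if \<phi>: "\<phi> \<in> carrier (smooth_dual M D)" and \<psi>: "\<psi> \<in> carrier (smooth_dual M D)" for \<phi> \<psi> a b
  proof -
    have "smooth_map D real_dspace (\<lambda>v\<in>carrier M. a * \<phi> v + b * \<psi> v)"
      unfolding smooth_map_real_iff
    proof (intro allI impI)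
      fix n U p assume p: "plots D n U p"
      then have "smooth_fun n U (\<lambda>u. a * (\<phi> \<circ> p) u + b * (\<psi> \<circ> p) u)"
        using \<phi> \<psi> unfolding mem_smooth_dual_iff smooth_map_real_iff
        by (intro smooth_fun_lincomb) blast+
      then show "smooth_fun n U ((\<lambda>v\<in>carrier M. a * \<phi> v + b * \<psi> v) \<circ> p)"
        by (rule smooth_fun_cong) (use diffeological_space_plotD(2)[OF D(1) p] D(2) in auto)
    qed
    then show ?thesis
      using \<phi> \<psi> by (auto simp: mem_smooth_dual_iff linear_maps_real_iff algebra_simps)
  qed
  have zero: "(\<lambda>v\<in>carrier M. 0) \<in> carrier (smooth_dual M D)"
  proof -
    have "smooth_map D real_dspace (\<lambda>v\<in>carrier M. 0)"
      unfolding smooth_map_real_iff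
    proof (intro allI impI)
      fix n U p assume p: "plots D n U p"
      show "smooth_fun n U ((\<lambda>v\<in>carrier M. 0) \<circ> p)"
        by (rule smooth_fun_cong[OF smooth_fun_zero])
          (use diffeological_space_plotD[OF D(1) p] D(2) in auto)
    qed
    then show ?thesis
      by (auto simp: mem_smooth_dual_iff linear_maps_real_iff)
  qed
  have add: "(\<lambda>v\<in>carrier M. \<phi> v + \<psi> v) \<in> carrier (smooth_dual M D)"
    if "\<phi> \<in> carrier (smooth_dual M D)" "\<psi> \<in> carrier (smooth_dual M D)" for \<phi> \<psi>
    using comb[OF that, of 1 1] by simp
  have smult: "(\<lambda>v\<in>carrier M. r * \<phi> v) \<in> carrier (smooth_dual M D)"
    if "\<phi> \<in> carrier (smooth_dual M D)" for \<phi> r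
    using comb[OF that that, of r 0] by simp
  show ?thesis
    unfolding submodule_def fun_module_simps
    using add smult zero F.module_axioms
    by (auto simp: mem_smooth_dual_iff extensional_def PiE_def)
qed

text \<open>\<open>form_rank\<close> is the dimension of the image of \<open>?T\<close>. This map is
  linear into the smooth dual, whose dimension equals that rank, and a subspace of full finite
  dimension is the whole space.\<close>

lemma vs_pseudo_metric_surj:
  assumes M: "real_vectorspace M" and fd: "vectorspace.fin_dim class_ring M"
    and D: "diffeological_space D" "points D = carrier M"
    and g: "vs_pseudo_metric M D g"
  shows "(\<lambda>v. \<lambda>w\<in>carrier M. g v w) ` carrier M = carrier (smooth_dual M D)"
proof -
  interpret M: vectorspace "class_ring :: real ring" M by fact
  let ?F = "fun_module (carrier M)"
  let ?L = "carrier (smooth_dual M D)"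
  let ?T = "\<lambda>v. \<lambda>w\<in>carrier M. g v w"
  interpret F: vectorspace "class_ring :: real ring" ?F
    by (rule vectorspace_fun_module)
  have sub: "subspace class_ring ?L ?F"
    unfolding subspace_def using submodule_smooth_dual[OF M D] F.vectorspace_axioms by auto
  interpret L: vectorspace "class_ring :: real ring" "F.vs ?L"
    using sub by (rule F.subspace_is_vs)
  have eq: "smooth_dual M D = F.vs ?L" by (simp add: smooth_dual_def)
  \<comment> \<open>Equality of dimensions forces equality of spaces only in finite dimension, which
    the dual inherits from \<open>M\<close>.\<close>
  have fdL: "L.fin_dim"
    by (rule fin_dim_linear_functionals[OF M fd sub]) (auto simp: mem_smooth_dual_iff)
  have lin1: "(\<lambda>w. g v w) \<in> linear_maps M real_module"
    and lin2: "(\<lambda>w. g w v) \<in> linear_maps M real_module" if "v \<in> carrier M" for v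
    using g that unfolding vs_pseudo_metric_def by auto
  have T: "?T v \<in> ?L" if "v \<in> carrier M" for v
  proof -
    have "smooth_map D real_dspace (?T v)"
      unfolding smooth_map_real_iff
    proof (intro allI impI)
      fix n U p assume p: "plots D n U p"
      note pD = diffeological_space_plotD[OF D(1) p]
      \<comment> \<open>Fixing the first argument of \<open>g\<close> amounts to pairing a plot with
        a constant plot.\<close>
      have "plots (prod_dspace D D) n U (\<lambda>u. (v, p u))"
        using p diffeological_space_const[OF D(1) pD(1)] that D(2)
        by (simp add: prod_dspace_def comp_def)
      then have "smooth_fun n U ((\<lambda>(v, w). g v w) \<circ> (\<lambda>u. (v, p u)))"
        using g unfolding vs_pseudo_metric_def smooth_map_real_iff by blast
      then show "smooth_fun n U (?T v \<circ> p)"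
        by (rule smooth_fun_cong) (use pD(2) D(2) in auto)
    qed
    then show ?thesis
      using lin1[OF that] by (auto simp: mem_smooth_dual_iff linear_maps_real_iff)
  qed
  have "?T \<in> module_hom class_ring M (F.vs ?L)"
    using T lin2 by (auto simp: module_hom_def fun_module_simps linear_maps_real_iff real_module_def intro!: restrict_ext)
  then interpret T: linear_map "class_ring :: real ring" M "F.vs ?L" ?T
    by unfold_locales
  have "form_rank M g = vdim (smooth_dual M D)"
    using g by (simp add: vs_pseudo_metric_def)
  then have "vectorspace.dim class_ring (L.vs (?T ` carrier M)) = L.dim"
    unfolding form_rank_def eq[symmetric] by (simp add: smooth_dual_def)
  then have "?T ` carrier M = carrier (F.vs ?L)"
    using T.imT_is_subspace by (intro L.subspace_eqI_dim[OF fdL]) (auto simp: T.im_def)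
  then show ?thesis by simp
qed

text \<open>Injectivity makes \<open>inv_into\<close> undo \<open>j\<close>, so the operations of
  \<open>image_module j M\<close> are those of \<open>M\<close> read through
  \<open>j\<close>.\<close>

lemma linear_maps_image_module_iff:
  assumes M: "real_vectorspace M" and inj: "inj_on j (carrier M)"
  shows "\<eta> \<in> linear_maps (image_module j M) real_module \<longleftrightarrow>
     (\<lambda>v\<in>carrier M. \<eta> (j v)) \<in> linear_maps M real_module"
proof -
  interpret M: vectorspace "class_ring :: real ring" M by fact
  show ?thesis using inj by (auto simp: linear_maps_real_iff image_module_def)
qed

text \<open>Every plot of \<open>D'\<close> lifts locally along \<open>j\<close> to \<open>D\<close>, so smoothness on \<open>D'\<close> can be tested on \<open>D\<close>.\<close>

lemma bij_betw_smooth_dual_image: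
  assumes M: "real_vectorspace M" and inj: "inj_on j (carrier M)"
    and D: "\<And>n U p. plots D n U p \<Longrightarrow> openin (Euclidean_space n) U \<and> p ` U \<subseteq> carrier M \<and> plots D' n U (j \<circ> p)"
    and lift: "\<And>n U p. plots D' n U p \<Longrightarrow> openin (Euclidean_space n) U \<and>
      (\<forall>u\<in>U. \<exists>W q. u \<in> W \<and> W \<subseteq> U \<and> plots D n W q \<and> (\<forall>w\<in>W. p w = j (q w)))"
  shows "bij_betw (\<lambda>\<eta>. \<lambda>v\<in>carrier M. \<eta> (j v))
    (carrier (smooth_dual (image_module j M) D')) (carrier (smooth_dual M D))"
proof -
  have carr: "carrier (image_module j M) = j ` carrier M"
    by (simp add: image_module_def)
  have smooth: "smooth_map D' real_dspace \<eta> \<longleftrightarrow> smooth_map D real_dspace (\<lambda>v\<in>carrier M. \<eta> (j v))" for \<eta>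
  proof
    assume \<eta>: "smooth_map D' real_dspace \<eta>"
    show "smooth_map D real_dspace (\<lambda>v\<in>carrier M. \<eta> (j v))"
      unfolding smooth_map_real_iff
    proof (intro allI impI)
      fix n U p assume "plots D n U p"
      then have p: "p ` U \<subseteq> carrier M" "plots D' n U (j \<circ> p)" using D by auto
      have "smooth_fun n U (\<eta> \<circ> (j \<circ> p))" using \<eta> p(2) unfolding smooth_map_real_iff by blast
      then show "smooth_fun n U ((\<lambda>v\<in>carrier M. \<eta> (j v)) \<circ> p)"
        by (rule smooth_fun_cong) (use p(1) in auto)
    qed
  next
    assume \<eta>: "smooth_map D real_dspace (\<lambda>v\<in>carrier M. \<eta> (j v))"
    show "smooth_map D' real_dspace \<eta>"
      unfolding smooth_map_real_iff
    proof (intro allI impI)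
      fix n U p assume p: "plots D' n U p"
      show "smooth_fun n U (\<eta> \<circ> p)"
      proof (rule smooth_fun_local)
        show "openin (Euclidean_space n) U" using lift[OF p] by simp
        fix u assume "u \<in> U"
        then obtain W q where W: "u \<in> W" "W \<subseteq> U" "plots D n W q" "\<forall>w\<in>W. p w = j (q w)"
          using lift[OF p] by blast
        have "smooth_fun n W ((\<lambda>v\<in>carrier M. \<eta> (j v)) \<circ> q)"
          using \<eta> W(3) unfolding smooth_map_real_iff by blast
        then have "smooth_fun n W (\<eta> \<circ> p)"
          by (rule smooth_fun_cong) (use D[OF W(3)] W(4) in auto)
        then show "\<exists>W. u \<in> W \<and> W \<subseteq> U \<and> smooth_fun n W (\<eta> \<circ> p)" using W by blast
      qed
    qed
  qed
  have mem: "\<eta> \<in> carrier (smooth_dual (image_module j M) D') \<longleftrightarrow>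
      \<eta> \<in> extensional (j ` carrier M) \<and> (\<lambda>v\<in>carrier M. \<eta> (j v)) \<in> carrier (smooth_dual M D)" for \<eta>
    using linear_maps_image_module_iff[OF M inj] smooth by (simp add: mem_smooth_dual_iff carr)
  show ?thesis
  \<comment> \<open>The inverse transports a functional along \<open>inv_into\<close>; off the image
    of \<open>j\<close> it is \<open>undefined\<close>, as elements of the smooth dual must
    be.\<close>
  proof (rule bij_betwI[where g = "\<lambda>\<xi>. \<lambda>a\<in>j ` carrier M. \<xi> (inv_into (carrier M) j a)"])
    show "(\<lambda>\<eta>. \<lambda>v\<in>carrier M. \<eta> (j v))
        \<in> carrier (smooth_dual (image_module j M) D') \<rightarrow> carrier (smooth_dual M D)"
      using mem by auto
    have *: "(\<lambda>v\<in>carrier M. (\<lambda>a\<in>j ` carrier M. \<xi> (inv_into (carrier M) j a)) (j v)) = \<xi>"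
      if "\<xi> \<in> carrier (smooth_dual M D)" for \<xi>
      using that inj by (intro extensionalityI[where A = "carrier M"]) (auto simp: mem_smooth_dual_iff)
    then show "(\<lambda>v\<in>carrier M. (\<lambda>a\<in>j ` carrier M. \<xi> (inv_into (carrier M) j a)) (j v)) = \<xi>"
      if "\<xi> \<in> carrier (smooth_dual M D)" for \<xi> using that .
    show "(\<lambda>\<xi>. \<lambda>a\<in>j ` carrier M. \<xi> (inv_into (carrier M) j a))
        \<in> carrier (smooth_dual M D) \<rightarrow> carrier (smooth_dual (image_module j M) D')"
      using * by (intro funcsetI) (simp only: mem restrict_extensional simp_thms)
    show "(\<lambda>a\<in>j ` carrier M. (\<lambda>v\<in>carrier M. \<eta> (j v)) (inv_into (carrier M) j a)) = \<eta>"
      if "\<eta> \<in> carrier (smooth_dual (image_module j M) D')" for \<eta>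
      using that inj by (intro extensionalityI[where A = "j ` carrier M"]) (auto simp: mem)
  qed
qed

section \<open>Dual forms and their transport along isomorphisms of fibres\<close>

lemma Psi_eq_iff:
  "(c, \<eta>) = Psi B g v \<longleftrightarrow> c = proj B v \<and> \<eta> = (\<lambda>w\<in>carrier (fibre B (proj B v)). g (proj B v) v w)"
  by (simp add: Psi_def)

text \<open>\<open>j\<close> matches the vectors representing \<open>(c, \<eta>)\<close> under
  \<open>Psi G g'\<close> with those representing its pullback under \<open>Psi B g\<close>. The two
  predicates under \<open>THE\<close> are therefore equal, before anything is known about existence
  or uniqueness of the value.\<close>

lemma dual_metric_image:
  assumes carr: "carrier (fibre G c) = j ` carrier (fibre B x)" 
    and projB: "\<And>v. v \<in> carrier (fibre B x) \<Longrightarrow> proj B v = x"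
    and projG: "\<And>v. v \<in> carrier (fibre B x) \<Longrightarrow> proj G (j v) = c"
    and g: "\<And>v w. v \<in> carrier (fibre B x) \<Longrightarrow> w \<in> carrier (fibre B x) \<Longrightarrow> g' c (j v) (j w) = g x v w"
    and \<eta>: "\<eta> \<in> extensional (carrier (fibre G c))" and \<eta>': "\<eta>' \<in> extensional (carrier (fibre G c))"
  shows "dual_metric G g' c (c, \<eta>) (c, \<eta>') =
    dual_metric B g x (x, \<lambda>v\<in>carrier (fibre B x). \<eta> (j v)) (x, \<lambda>v\<in>carrier (fibre B x). \<eta>' (j v))"
proof -
  let ?C = "carrier (fibre B x)"
  have *: "(c, \<eta>) = Psi G g' (j v) \<longleftrightarrow> (x, \<lambda>v\<in>?C. \<eta> (j v)) = Psi B g v"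
    if v: "v \<in> ?C" and \<eta>: "\<eta> \<in> extensional (carrier (fibre G c))" for v \<eta>
  proof -
    have "\<eta> = (\<lambda>b\<in>j ` ?C. g' c (j v) b) \<longleftrightarrow> (\<forall>w\<in>?C. \<eta> (j w) = g' c (j v) (j w))"
      using \<eta> unfolding carr
      by (auto intro!: extensionalityI[where A = "j ` ?C"])
    also have "\<dots> \<longleftrightarrow> (\<forall>w\<in>?C. \<eta> (j w) = g x v w)" using g v by auto
    also have "\<dots> \<longleftrightarrow> (\<lambda>w\<in>?C. \<eta> (j w)) = (\<lambda>w\<in>?C. g x v w)"
      by (auto simp: fun_eq_iff restrict_def)
    finally show ?thesis
      using v projB projG by (simp add: Psi_eq_iff carr)
  qed
  show ?thesis
    unfolding dual_metric_def carr
    by (rule arg_cong[where f = The]) (use * \<eta> \<eta>' g in \<open>auto simp: fun_eq_iff\<close>)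
qed

text \<open>Replacing \<open>v\<close> by a vector with the same \<open>Psi\<close> leaves every
  \<open>g x v w\<close> unchanged. Symmetry allows the same replacement in the second argument, so
  the value under \<open>THE\<close> is unique.\<close>

lemma dual_metric_Psi:
  assumes proj: "\<And>v. v \<in> carrier (fibre B x) \<Longrightarrow> proj B v = x"
    and sym: "\<And>v w. v \<in> carrier (fibre B x) \<Longrightarrow> w \<in> carrier (fibre B x) \<Longrightarrow> g x v w = g x w v"
    and v: "v \<in> carrier (fibre B x)" and w: "w \<in> carrier (fibre B x)"
  shows "dual_metric B g x (Psi B g v) (Psi B g w) = g x v w"
proof -
  let ?C = "carrier (fibre B x)"
  have Psi: "g x v w = g x v' w" if "Psi B g v = Psi B g v'" "v \<in> ?C" "v' \<in> ?C" "w \<in> ?C" for v v' w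
    using that proj by (auto simp: Psi_def fun_eq_iff restrict_def split: if_splits)
  have "r = g x v w" if "\<exists>v'\<in>?C. \<exists>w'\<in>?C. Psi B g v = Psi B g v' \<and> Psi B g w = Psi B g w' \<and> r = g x v' w'" for r
  proof -
    obtain v' w' where *: "v' \<in> ?C" "w' \<in> ?C" "Psi B g v = Psi B g v'" "Psi B g w = Psi B g w'" "r = g x v' w'"
      using \<open>\<exists>v'\<in>?C. _\<close> by blast
    have "g x v w = g x v' w" using Psi * v w by blast
    also have "\<dots> = g x w v'" using sym * w by blast
    also have "\<dots> = g x w' v'" using Psi * v w by blast
    also have "\<dots> = r" using sym * by blast
    finally show ?thesis by simp
  qed
  then show ?thesis
    unfolding dual_metric_def using v w by (intro the_equality) blast+
qed

section \<open>Glued spaces and bundles\<close>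

text \<open>The canonical representative of a class, chosen in the second space whenever possible.
  The gluing relation is the kernel of this map.\<close>

definition glue_rep :: "'a set \<Rightarrow> ('a \<Rightarrow> 'b) \<Rightarrow> 'a + 'b \<Rightarrow> 'a + 'b" where
  "glue_rep Y h a = (case a of Inl z \<Rightarrow> if z \<in> Y then Inr (h z) else Inl z | Inr z \<Rightarrow> Inr z)"

lemma glue_rep_simps [simp]:
  "z \<in> Y \<Longrightarrow> glue_rep Y h (Inl z) = Inr (h z)"
  "z \<notin> Y \<Longrightarrow> glue_rep Y h (Inl z) = Inl z"
  "glue_rep Y h (Inr w) = Inr w"
  by (simp_all add: glue_rep_def)

text \<open>The representative does not change along a generating step, and every point reaches its
  representative in at most one such step.\<close>

lemma equivclp_glue_iff:
  "equivclp (\<lambda>c d. \<exists>z\<in>Y. c = Inl z \<and> d = Inr (h z)) a b \<longleftrightarrow> glue_rep Y h a = glue_rep Y h b"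
    (is "equivclp ?R a b \<longleftrightarrow> _")
proof
  show "glue_rep Y h a = glue_rep Y h b" if "equivclp ?R a b"
    using that by (induction rule: equivclp_induct) auto
next
  have rep: "equivclp ?R c (glue_rep Y h c)" for c
  proof (cases "\<exists>z\<in>Y. c = Inl z")
    case True
    then show ?thesis by (intro r_into_equivclp) auto
  next
    case False
    then have "glue_rep Y h c = c" by (cases c) auto
    then show ?thesis by simp
  qed
  assume "glue_rep Y h a = glue_rep Y h b"
  then have "equivclp ?R (glue_rep Y h a) b"
    using equivclp_sym[OF rep[of b]] by (simp only:)
  with rep[of a] show "equivclp ?R a b"
    by (rule equivclp_trans)
qed

section \<open>Classes, inclusions and local lifts of plots in a glued space\<close>

locale glue_spaces =
  fixes Z1 :: "'a dspace" and Z2 :: "'b dspace" and Y :: "'a set" and h :: "'a \<Rightarrow> 'b"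
  assumes Y: "Y \<subseteq> points Z1" and h: "h ` Y \<subseteq> points Z2"
begin

abbreviation "S \<equiv> points (sum_dspace Z1 Z2)"
abbreviation "rep \<equiv> glue_rep Y h"
abbreviation "cls a \<equiv> glue_rel Z1 Z2 Y h `` {a}"
abbreviation "i1 \<equiv> incl1 Z1 Z2 Y h"
abbreviation "i2 \<equiv> incl2 Z1 Z2 Y h"

lemma mem_S [simp]: "Inl z \<in> S \<longleftrightarrow> z \<in> points Z1" "Inr w \<in> S \<longleftrightarrow> w \<in> points Z2"
  by (auto simp: sum_dspace_def)

lemma cls_eq: "a \<in> S \<Longrightarrow> cls a = {b \<in> S. rep b = rep a}"
  by (auto simp: glue_rel_def equivclp_glue_iff)

lemma cls_eq_iff: "a \<in> S \<Longrightarrow> b \<in> S \<Longrightarrow> cls a = cls b \<longleftrightarrow> rep a = rep b"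
  by (auto simp: cls_eq)

text \<open>If the representative is \<open>Inr w\<close>, then \<open>w\<close> is the only point
  of \<open>Z2\<close> in the class; if it is \<open>Inl w\<close>, the class is the single point
  \<open>Inl w\<close>, with \<open>w\<close> outside \<open>Y\<close>.\<close>

lemma unglue_cls: "a \<in> S \<Longrightarrow> unglue (cls a) = rep a"
proof -
  assume a: "a \<in> S"
  show ?thesis
  proof (cases "rep a")
    case (Inr w)
    then have "w \<in> points Z2" using a h by (cases a) (auto simp: glue_rep_def split: if_splits)
    then have "Inr z \<in> cls a \<longleftrightarrow> z = w" for z using a Inr by (auto simp: cls_eq)
    then show ?thesis using Inr by (auto simp: unglue_def)
  next
    case (Inl w)
    then have aw: "a = Inl w" "w \<notin> Y" by (cases a; auto simp: glue_rep_def split: if_splits)+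
    have "Inr z \<notin> cls a" for z using a Inl by (auto simp: cls_eq)
    moreover have "Inl z \<in> cls a \<longleftrightarrow> z = w" for z
      using a aw Inl by (cases "z \<in> Y") (auto simp: cls_eq)
    ultimately show ?thesis using Inl by (auto simp: unglue_def)
  qed
qed

lemma unglue_incl:
  "z \<in> points Z1 - Y \<Longrightarrow> unglue (i1 z) = Inl z"
  "w \<in> points Z2 \<Longrightarrow> unglue (i2 w) = Inr w"
  by (simp_all add: incl1_def incl2_def unglue_cls)

lemma incl1_eq_incl2: "z \<in> Y \<Longrightarrow> i1 z = i2 (h z)"
  unfolding incl1_def incl2_def by (subst cls_eq_iff) (use Y h in auto)

lemma inj_on_incl1: "inj_on i1 (points Z1 - Y)"
  by (rule inj_on_inverseI[where g = "projl \<circ> unglue"]) (simp add: unglue_incl)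

lemma inj_on_incl2: "inj_on i2 (points Z2)"
  by (rule inj_on_inverseI[where g = "projr \<circ> unglue"]) (simp add: unglue_incl)

text \<open>Here \<open>z\<close> ranges over all of \<open>Z1\<close>, since a local lift of a plot
  is not known in advance to avoid \<open>Y\<close>.\<close>

lemma incl1_cancel: "z \<in> points Z1 \<Longrightarrow> z' \<in> points Z1 - Y \<Longrightarrow> i1 z = i1 z' \<Longrightarrow> z = z'"
  by (cases "z \<in> Y") (auto simp: incl1_def cls_eq_iff)

lemma incl2_neq_incl1: "w \<in> points Z2 \<Longrightarrow> z \<in> points Z1 - Y \<Longrightarrow> i2 w \<noteq> i1 z"
  by (auto simp: incl1_def incl2_def cls_eq_iff)

lemma incl1_eq_incl2D: "z \<in> points Z1 \<Longrightarrow> w \<in> points Z2 \<Longrightarrow> i1 z = i2 w \<Longrightarrow> z \<in> Y \<and> h z = w"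
  by (cases "z \<in> Y") (auto simp: incl1_def incl2_def cls_eq_iff)

lemma points_glue: "points (glue Z1 Z2 Y h) = i1 ` (points Z1 - Y) \<union> i2 ` points Z2"
proof -
  have "points (glue Z1 Z2 Y h) = (\<lambda>a. cls a) ` S"
    by (auto simp: glue_def quot_dspace_def quotient_def)
  also have "\<dots> = i1 ` points Z1 \<union> i2 ` points Z2"
    by (auto simp: sum_dspace_def image_Un image_image incl1_def incl2_def)
  also have "\<dots> = i1 ` (points Z1 - Y) \<union> i2 ` points Z2"
    using incl1_eq_incl2 h by fastforce
  finally show ?thesis .
qed

lemma plots_glue_incl1:
  assumes "plots Z1 n U p" "openin (Euclidean_space n) U"
  shows "plots (glue Z1 Z2 Y h) n U (i1 \<circ> p)"
  using assms unfolding glue_def quot_dspace_def sum_dspace_def dspace.simps incl1_def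
  by (intro conjI ballI exI[of _ U] exI[of _ "Inl \<circ> p"]) auto

lemma plots_glue_incl2:
  assumes "plots Z2 n U p" "openin (Euclidean_space n) U"
  shows "plots (glue Z1 Z2 Y h) n U (i2 \<circ> p)"
  using assms unfolding glue_def quot_dspace_def sum_dspace_def dspace.simps incl2_def
  by (intro conjI ballI exI[of _ U] exI[of _ "Inr \<circ> p"]) auto

text \<open>Plots of a quotient lift locally to the disjoint union, and plots of the latter lie
  locally in one summand; shrinking twice gives the two cases. A lift into \<open>Z1\<close> may
  pass through \<open>Y\<close>.\<close>

lemma plots_glue_lift:
  assumes p: "plots (glue Z1 Z2 Y h) n U p" and u: "u \<in> U"
  obtains W q where "u \<in> W" "W \<subseteq> U" "plots Z1 n W q" "\<And>w. w \<in> W \<Longrightarrow> p w = i1 (q w)"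
    | W q where "u \<in> W" "W \<subseteq> U" "plots Z2 n W q" "\<And>w. w \<in> W \<Longrightarrow> p w = i2 (q w)"
proof -
  obtain W q where W: "u \<in> W" "W \<subseteq> U" "plots (sum_dspace Z1 Z2) n W q"
      "\<forall>w\<in>W. p w = cls (q w)"
    using p u unfolding glue_def quot_dspace_def by auto
  obtain W' where W': "u \<in> W'" "W' \<subseteq> W"
    "(\<exists>r. plots Z1 n W' r \<and> (\<forall>w\<in>W'. q w = Inl (r w))) \<or>
     (\<exists>r. plots Z2 n W' r \<and> (\<forall>w\<in>W'. q w = Inr (r w)))"
    using W(1,3) unfolding sum_dspace_def dspace.simps by blast
  from W'(3) show thesis
  proof
    assume "\<exists>r. plots Z1 n W' r \<and> (\<forall>w\<in>W'. q w = Inl (r w))"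
    then obtain r where r: "plots Z1 n W' r" "\<And>w. w \<in> W' \<Longrightarrow> q w = Inl (r w)" by blast
    show thesis
    proof (rule that(1))
      show "u \<in> W'" by fact
      show "W' \<subseteq> U" using W' W by blast
      show "plots Z1 n W' r" by fact
      show "p w = i1 (r w)" if "w \<in> W'" for w
        using that W(4) W'(2) r(2)[OF that] by (auto simp: incl1_def)
    qed
  next
    assume "\<exists>r. plots Z2 n W' r \<and> (\<forall>w\<in>W'. q w = Inr (r w))"
    then obtain r where r: "plots Z2 n W' r" "\<And>w. w \<in> W' \<Longrightarrow> q w = Inr (r w)" by blast
    show thesis
    proof (rule that(2))
      show "u \<in> W'" by fact
      show "W' \<subseteq> U" using W' W by blast
      show "plots Z2 n W' r" by fact
      show "p w = i2 (r w)" if "w \<in> W'" for w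
        using that W(4) W'(2) r(2)[OF that] by (auto simp: incl2_def)
    qed
  qed
qed

end

text \<open>The set-level data of a gluing. In this form the locale applies both to the given
  bundles and, with roles exchanged, to their duals, whose pseudo-bundle axioms then do not have to
  be verified.\<close>

locale glue_bundles =
  fixes B1 :: "('x1, 'v1) pbundle" and B2 :: "('x2, 'v2) pbundle"
    and Y :: "'x1 set" and f :: "'x1 \<Rightarrow> 'x2" and ft :: "'v1 \<Rightarrow> 'v2"
  assumes carrier_fibre1: "x \<in> points (base B1) \<Longrightarrow> carrier (fibre B1 x) = over B1 {x}"
    and carrier_fibre2: "z \<in> points (base B2) \<Longrightarrow> carrier (fibre B2 z) = over B2 {z}"
    and proj1: "v \<in> points (total B1) \<Longrightarrow> proj B1 v \<in> points (base B1)"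
    and proj2: "w \<in> points (total B2) \<Longrightarrow> proj B2 w \<in> points (base B2)"
    and Y_base: "Y \<subseteq> points (base B1)" and f_base: "f ` Y \<subseteq> points (base B2)"
    and ft_total: "ft ` over B1 Y \<subseteq> points (total B2)"
    and proj_ft: "v \<in> over B1 Y \<Longrightarrow> proj B2 (ft v) = f (proj B1 v)"
begin

sublocale base: glue_spaces "base B1" "base B2" Y f
  using Y_base f_base by unfold_locales

sublocale total: glue_spaces "total B1" "total B2" "over B1 Y" ft
  using ft_total by unfold_locales (auto simp: over_def)

abbreviation "G \<equiv> glue_bundle B1 B2 Y ft f"

section \<open>Fibres, projection and forms of the glued bundle\<close>

lemma glue_bundle_simps [simp]:
  "base G = glue (base B1) (base B2) Y f"
  "total G = glue (total B1) (total B2) (over B1 Y) ft"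
  by (simp_all add: glue_bundle_def)

lemma fibre_glue1: "x \<in> points (base B1) - Y \<Longrightarrow> fibre G (base.i1 x) = image_module total.i1 (fibre B1 x)"
  by (simp add: glue_bundle_def base.unglue_incl)

lemma fibre_glue2: "x \<in> points (base B2) \<Longrightarrow> fibre G (base.i2 x) = image_module total.i2 (fibre B2 x)"
  by (simp add: glue_bundle_def base.unglue_incl)

lemma fibre1_subset: "x \<in> points (base B1) - Y \<Longrightarrow> carrier (fibre B1 x) \<subseteq> points (total B1) - over B1 Y"
  by (auto simp: carrier_fibre1 over_def)

lemma fibre2_subset: "x \<in> points (base B2) \<Longrightarrow> carrier (fibre B2 x) \<subseteq> points (total B2)"
  by (auto simp: carrier_fibre2 over_def)

lemma inj_on_fibre1: "x \<in> points (base B1) - Y \<Longrightarrow> inj_on total.i1 (carrier (fibre B1 x))"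
  using fibre1_subset total.inj_on_incl1 inj_on_subset by blast

lemma inj_on_fibre2: "x \<in> points (base B2) \<Longrightarrow> inj_on total.i2 (carrier (fibre B2 x))"
  using fibre2_subset total.inj_on_incl2 inj_on_subset by blast

lemma carrier_glue1:
  "x \<in> points (base B1) - Y \<Longrightarrow> carrier (fibre G (base.i1 x)) = total.i1 ` carrier (fibre B1 x)"
  by (simp add: fibre_glue1 image_module_def)

lemma carrier_glue2:
  "x \<in> points (base B2) \<Longrightarrow> carrier (fibre G (base.i2 x)) = total.i2 ` carrier (fibre B2 x)"
  by (simp add: fibre_glue2 image_module_def)

lemma proj_glue1: "v \<in> points (total B1) - over B1 Y \<Longrightarrow> proj G (total.i1 v) = base.i1 (proj B1 v)"
  by (simp add: glue_bundle_def total.unglue_incl)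

lemma proj_glue2: "v \<in> points (total B2) \<Longrightarrow> proj G (total.i2 v) = base.i2 (proj B2 v)"
  by (simp add: glue_bundle_def total.unglue_incl)

text \<open>Over \<open>Y\<close> the class of \<open>v\<close> is that of \<open>ft v\<close>, and
  \<open>ft\<close> lifts \<open>f\<close>, so the formula persists for lifts of plots that meet
  \<open>Y\<close>.\<close>

lemma proj_glue_incl1:
  assumes "v \<in> points (total B1)"
  shows "proj G (total.i1 v) = base.i1 (proj B1 v)"
  using assms
proof (cases "v \<in> over B1 Y")
  case True
  moreover have "ft v \<in> points (total B2)" using True ft_total by blast
  moreover have "proj B1 v \<in> Y" using True by (simp add: over_def)
  ultimately show ?thesis
    by (simp add: total.incl1_eq_incl2 proj_glue2 proj_ft base.incl1_eq_incl2)
qed (simp add: proj_glue1)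

lemma incl1_mem_over:
  assumes "x \<in> points (base B1) - Y" "v \<in> over B1 {x}"
  shows "total.i1 v \<in> over G {base.i1 x}"
proof -
  have v: "v \<in> points (total B1)" "proj B1 v = x" using assms(2) by (simp_all add: over_def)
  then have "v \<notin> over B1 Y" using assms(1) by (simp add: over_def)
  with v show ?thesis
    by (simp add: over_def[of G] total.points_glue proj_glue_incl1)
qed

lemma incl2_mem_over: "v \<in> over B2 {x} \<Longrightarrow> total.i2 v \<in> over G {base.i2 x}"
  by (simp add: over_def[of G] over_def[of B2] total.points_glue proj_glue2)

lemma glue_metric1:
  assumes "x \<in> points (base B1) - Y" "v \<in> carrier (fibre B1 x)" "w \<in> carrier (fibre B1 x)"
  shows "glue_metric B1 B2 Y ft g1 g2 (base.i1 x) (total.i1 v) (total.i1 w) = g1 x v w"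
  using assms inj_on_fibre1[OF assms(1)] by (simp add: glue_metric_def base.unglue_incl)

lemma glue_metric2:
  assumes "x \<in> points (base B2)" "v \<in> carrier (fibre B2 x)" "w \<in> carrier (fibre B2 x)"
  shows "glue_metric B1 B2 Y ft g1 g2 (base.i2 x) (total.i2 v) (total.i2 w) = g2 x v w"
  using assms inj_on_fibre2[OF assms(1)] by (simp add: glue_metric_def base.unglue_incl)

end

section \<open>Duals of glued bundles\<close>

lemma carrier_fibre_dual_bundle:
  "carrier (fibre (dual_bundle B) x) = Pair x ` carrier (smooth_dual (fibre B x) (fibre_space B x))"
  by (simp add: dual_bundle_def image_module_def)

lemma dual_bundle_simps:
  "base (dual_bundle B) = base B" "total (dual_bundle B) = dual_total B" "proj (dual_bundle B) = fst"
  by (simp_all add: dual_bundle_def)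

lemma mem_points_dual_bundle:
  "(x, \<phi>) \<in> points (total (dual_bundle B)) \<longleftrightarrow>
    x \<in> points (base B) \<and> \<phi> \<in> carrier (smooth_dual (fibre B x) (fibre_space B x))"
  by (simp add: dual_bundle_simps dual_total_def)

lemma over_dual_bundle:
  "over (dual_bundle B) A =
    (SIGMA x:points (base B) \<inter> A. carrier (smooth_dual (fibre B x) (fibre_space B x)))"
  by (auto simp: over_def dual_bundle_def dual_total_def)

lemma carrier_dual_fibre:
  "x \<in> points (base B) \<Longrightarrow> carrier (fibre (dual_bundle B) x) = over (dual_bundle B) {x}"
  by (auto simp: carrier_fibre_dual_bundle over_dual_bundle)

lemma pseudo_bundleD:
  assumes "pseudo_bundle B"
  shows "diffeological_space (total B)"
    and "x \<in> points (base B) \<Longrightarrow> real_vectorspace (fibre B x)"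
    and "x \<in> points (base B) \<Longrightarrow> carrier (fibre B x) = over B {x}"
    and "v \<in> points (total B) \<Longrightarrow> proj B v \<in> points (base B)"
  using assms unfolding pseudo_bundle_def by auto

lemma proj_carrier_fibre:
  "pseudo_bundle B \<Longrightarrow> x \<in> points (base B) \<Longrightarrow> v \<in> carrier (fibre B x) \<Longrightarrow> proj B v = x"
  by (simp add: pseudo_bundleD(3) over_def)

lemma points_fibre_space:
  "pseudo_bundle B \<Longrightarrow> x \<in> points (base B) \<Longrightarrow> points (fibre_space B x) = carrier (fibre B x)"
  by (auto simp: pseudo_bundleD(3) fibre_space_def sub_dspace_def over_def)

lemma plots_fibre_space_iff:
  "plots (fibre_space B x) n U p \<longleftrightarrow> plots (total B) n U p \<and> p ` U \<subseteq> over B {x}"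
  by (simp add: fibre_space_def sub_dspace_def)

text \<open>The rank condition applied to one fibre, which is a diffeological space under the subset
  diffeology.\<close>

lemma Psi_surj:
  assumes B: "pseudo_bundle B" "finite_dimensional B" and g: "pseudo_metric B g"
    and x: "x \<in> points (base B)"
  shows "Psi B g ` carrier (fibre B x) = over (dual_bundle B) {x}"
proof -
  have "(\<lambda>v. \<lambda>w\<in>carrier (fibre B x). g x v w) ` carrier (fibre B x)
      = carrier (smooth_dual (fibre B x) (fibre_space B x))"
  proof (rule vs_pseudo_metric_surj)
    show "real_vectorspace (fibre B x)" using B x by (simp add: pseudo_bundleD)
    show "vectorspace.fin_dim class_ring (fibre B x)" using B x by (simp add: finite_dimensional_def)
    show "diffeological_space (fibre_space B x)"
      unfolding fibre_space_def using B by (intro diffeological_space_sub pseudo_bundleD)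
    show "points (fibre_space B x) = carrier (fibre B x)" using B x by (simp add: points_fibre_space)
    show "vs_pseudo_metric (fibre B x) (fibre_space B x) (g x)"
      using g x by (simp add: pseudo_metric_def)
  qed
  moreover have "Psi B g ` carrier (fibre B x) = (\<lambda>v. (x, \<lambda>w\<in>carrier (fibre B x). g x v w)) ` carrier (fibre B x)"
    using proj_carrier_fibre[OF B(1) x] by (intro image_cong) (simp_all add: Psi_def)
  ultimately have "Psi B g ` carrier (fibre B x) = Pair x ` carrier (smooth_dual (fibre B x) (fibre_space B x))"
    by (metis image_image)
  then show ?thesis using x by (auto simp: over_dual_bundle)
qed

locale glue_pseudo_bundles =
  fixes B1 :: "('x1, 'v1) pbundle" and B2 :: "('x2, 'v2) pbundle"
    and Y :: "'x1 set" and f :: "'x1 \<Rightarrow> 'x2" and ft :: "'v1 \<Rightarrow> 'v2"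
  assumes pb1: "pseudo_bundle B1" and pb2: "pseudo_bundle B2" and gl: "gluing B1 B2 Y ft f"
begin

lemma gluingD:
  shows "Y \<subseteq> points (base B1)"
    and "f ` Y \<subseteq> points (base B2)"
    and "ft ` over B1 Y \<subseteq> points (total B2)"
    and "v \<in> over B1 Y \<Longrightarrow> proj B2 (ft v) = f (proj B1 v)"
    and "plots (total B1) n U p \<Longrightarrow> p ` U \<subseteq> over B1 Y \<Longrightarrow> plots (total B2) n U (ft \<circ> p)"
proof -
  show Y: "Y \<subseteq> points (base B1)" using gl by (simp add: gluing_def)
  have f: "smooth_map (sub_dspace (base B1) Y) (base B2) f"
    and ft: "smooth_map (sub_dspace (total B1) (over B1 Y)) (total B2) ft"
    using gl by (simp_all add: gluing_def)
  show "f ` Y \<subseteq> points (base B2)"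
    using f Y by (auto simp: smooth_map_def sub_dspace_def)
  show "ft ` over B1 Y \<subseteq> points (total B2)"
    using ft by (auto simp: smooth_map_def sub_dspace_def over_def)
  show "proj B2 (ft v) = f (proj B1 v)" if "v \<in> over B1 Y"
    using gl that by (simp add: gluing_def)
  show "plots (total B2) n U (ft \<circ> p)" if "plots (total B1) n U p" "p ` U \<subseteq> over B1 Y"
    using ft that by (simp add: smooth_map_def sub_dspace_def)
qed

sublocale glue_bundles B1 B2 Y f ft
  using pb1 pb2 gluingD by unfold_locales (simp_all add: pseudo_bundleD)

section \<open>Smooth duals of the fibres of the glued bundle\<close>

abbreviation "dual1 x \<equiv> carrier (smooth_dual (fibre B1 x) (fibre_space B1 x))"
abbreviation "dual2 x \<equiv> carrier (smooth_dual (fibre B2 x) (fibre_space B2 x))"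
abbreviation "dualG c \<equiv> carrier (smooth_dual (fibre G c) (fibre_space G c))"
abbreviation "pull1 x \<eta> \<equiv> \<lambda>v\<in>carrier (fibre B1 x). \<eta> (total.i1 v)"
abbreviation "pull2 x \<eta> \<equiv> \<lambda>v\<in>carrier (fibre B2 x). \<eta> (total.i2 v)"

text \<open>A plot inside the fibre over \<open>base.i1 x\<close> lifts locally to the first bundle
  only, and the lift stays over \<open>x\<close> because \<open>x\<close> is outside
  \<open>Y\<close>. Smoothness on the glued fibre is thus smoothness on the original one.\<close>

lemma bij_betw_pull1:
  assumes x: "x \<in> points (base B1) - Y"
  shows "bij_betw (pull1 x) (dualG (base.i1 x)) (dual1 x)"
  unfolding fibre_glue1[OF x]
proof (rule bij_betw_smooth_dual_image)
  show "real_vectorspace (fibre B1 x)" using pb1 x by (simp add: pseudo_bundleD)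
  show "inj_on total.i1 (carrier (fibre B1 x))" using x by (rule inj_on_fibre1)
  fix n U p assume p: "plots (fibre_space B1 x) n U p"
  then have p': "plots (total B1) n U p" "p ` U \<subseteq> over B1 {x}" by (simp_all add: plots_fibre_space_iff)
  have U: "openin (Euclidean_space n) U"
    using diffeological_space_plotD(1)[OF pseudo_bundleD(1)[OF pb1] p'(1)] .
  have "(total.i1 \<circ> p) ` U \<subseteq> over G {base.i1 x}"
    using p'(2) incl1_mem_over[OF x] by auto
  then show "openin (Euclidean_space n) U \<and> p ` U \<subseteq> carrier (fibre B1 x) \<and>
      plots (fibre_space G (base.i1 x)) n U (total.i1 \<circ> p)"
    using p' U x total.plots_glue_incl1[OF p'(1) U] by (simp add: plots_fibre_space_iff carrier_fibre1)
next
  fix n U p assume "plots (fibre_space G (base.i1 x)) n U p"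
  then have p: "plots (total G) n U p" "p ` U \<subseteq> over G {base.i1 x}" by (simp_all add: plots_fibre_space_iff)
  have pG: "proj G (p u) = base.i1 x" if "u \<in> U" for u
    using p(2) that by (auto simp: over_def)
  show "openin (Euclidean_space n) U \<and>
      (\<forall>u\<in>U. \<exists>W q. u \<in> W \<and> W \<subseteq> U \<and> plots (fibre_space B1 x) n W q \<and> (\<forall>w\<in>W. p w = total.i1 (q w)))"
  proof (intro conjI ballI)
    show "openin (Euclidean_space n) U" using p(1) by (simp add: glue_def quot_dspace_def)
    fix u assume u: "u \<in> U"
    show "\<exists>W q. u \<in> W \<and> W \<subseteq> U \<and> plots (fibre_space B1 x) n W q \<and> (\<forall>w\<in>W. p w = total.i1 (q w))"
      using p(1)[simplified] u
    proof (cases rule: total.plots_glue_lift)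
      case (1 W q)
      have qW: "q ` W \<subseteq> points (total B1)"
        using diffeological_space_plotD(2)[OF pseudo_bundleD(1)[OF pb1] 1(3)] .
      have "proj B1 (q w) = x" if w: "w \<in> W" for w
      proof (rule base.incl1_cancel)
        show "base.i1 (proj B1 (q w)) = base.i1 x"
        proof -
          have "q w \<in> points (total B1)" "w \<in> U" using qW 1(2) w by auto
          then show ?thesis using pG[of w] 1(4)[OF w] proj_glue_incl1[of "q w"] by simp
        qed
        show "proj B1 (q w) \<in> points (base B1)" using qW w proj1 by auto
      qed fact
      then have "plots (fibre_space B1 x) n W q"
        using 1(3) qW by (auto simp: plots_fibre_space_iff over_def)
      then show ?thesis using 1 by blast
    next
      \<comment> \<open>A lift into the second bundle would put one base point into both disjoint
        images.\<close>
      case (2 W q)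
      have "q u \<in> points (total B2)"
        using diffeological_space_plotD(2)[OF pseudo_bundleD(1)[OF pb2] 2(3)] 2(1) by blast
      then have "base.i2 (proj B2 (q u)) = base.i1 x" "proj B2 (q u) \<in> points (base B2)"
        using pG[OF u] 2(1,4) by (auto simp: proj_glue2 proj2)
      then show ?thesis using base.incl2_neq_incl1 x by blast
    qed
  qed
qed

text \<open>Over the image of \<open>Y\<close> a plot in the fibre may lift locally to the first
  bundle rather than the second; \<open>ft\<close> converts such a lift into one to the
  second.\<close>

lemma bij_betw_pull2:
  assumes x: "x \<in> points (base B2)"
  shows "bij_betw (pull2 x) (dualG (base.i2 x)) (dual2 x)"
  unfolding fibre_glue2[OF x]
proof (rule bij_betw_smooth_dual_image)
  show "real_vectorspace (fibre B2 x)" using pb2 x by (simp add: pseudo_bundleD)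
  show "inj_on total.i2 (carrier (fibre B2 x))" using x by (rule inj_on_fibre2)
  fix n U p assume p: "plots (fibre_space B2 x) n U p"
  then have p': "plots (total B2) n U p" "p ` U \<subseteq> over B2 {x}" by (simp_all add: plots_fibre_space_iff)
  have U: "openin (Euclidean_space n) U"
    using diffeological_space_plotD(1)[OF pseudo_bundleD(1)[OF pb2] p'(1)] .
  have "(total.i2 \<circ> p) ` U \<subseteq> over G {base.i2 x}"
    using p'(2) incl2_mem_over by auto
  then show "openin (Euclidean_space n) U \<and> p ` U \<subseteq> carrier (fibre B2 x) \<and>
      plots (fibre_space G (base.i2 x)) n U (total.i2 \<circ> p)"
    using p' U x total.plots_glue_incl2[OF p'(1) U] by (simp add: plots_fibre_space_iff carrier_fibre2)
next
  fix n U p assume "plots (fibre_space G (base.i2 x)) n U p"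
  then have p: "plots (total G) n U p" "p ` U \<subseteq> over G {base.i2 x}" by (simp_all add: plots_fibre_space_iff)
  have pG: "proj G (p u) = base.i2 x" if "u \<in> U" for u
    using p(2) that by (auto simp: over_def)
  show "openin (Euclidean_space n) U \<and>
      (\<forall>u\<in>U. \<exists>W q. u \<in> W \<and> W \<subseteq> U \<and> plots (fibre_space B2 x) n W q \<and> (\<forall>w\<in>W. p w = total.i2 (q w)))"
  proof (intro conjI ballI)
    show "openin (Euclidean_space n) U" using p(1) by (simp add: glue_def quot_dspace_def)
    fix u assume u: "u \<in> U"
    show "\<exists>W q. u \<in> W \<and> W \<subseteq> U \<and> plots (fibre_space B2 x) n W q \<and> (\<forall>w\<in>W. p w = total.i2 (q w))"
      using p(1)[simplified] u
    proof (cases rule: total.plots_glue_lift)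
      case (1 W q)
      have qW: "q ` W \<subseteq> points (total B1)"
        using diffeological_space_plotD(2)[OF pseudo_bundleD(1)[OF pb1] 1(3)] .
      have Yf: "proj B1 (q w) \<in> Y \<and> f (proj B1 (q w)) = x" if w: "w \<in> W" for w
      proof (rule base.incl1_eq_incl2D)
        show "base.i1 (proj B1 (q w)) = base.i2 x"
        proof -
          have "q w \<in> points (total B1)" "w \<in> U" using qW 1(2) w by auto
          then show ?thesis using pG[of w] 1(4)[OF w] proj_glue_incl1[of "q w"] by simp
        qed
        show "proj B1 (q w) \<in> points (base B1)" using qW w proj1 by auto
      qed fact
      \<comment> \<open>The lift lies over \<open>Y\<close>, so \<open>ft \<circ> q\<close> is a
        plot by smoothness of \<open>ft\<close>, and it represents the same classes as
        \<open>q\<close>.\<close>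
      then have qY: "q ` W \<subseteq> over B1 Y" using qW by (auto simp: over_def)
      then have "plots (total B2) n W (ft \<circ> q)" using gluingD(5) 1(3) by blast
      moreover have "(ft \<circ> q) ` W \<subseteq> over B2 {x}"
        using qY Yf gluingD(3,4) unfolding over_def by fastforce
      moreover have "p w = total.i2 ((ft \<circ> q) w)" if "w \<in> W" for w
        using 1(4)[OF that] total.incl1_eq_incl2[of "q w"] qY that by auto
      ultimately show ?thesis
        using 1(1,2) unfolding plots_fibre_space_iff by blast
    next
      case (2 W q)
      have qW: "q ` W \<subseteq> points (total B2)"
        using diffeological_space_plotD(2)[OF pseudo_bundleD(1)[OF pb2] 2(3)] .
      have "proj B2 (q w) = x" if w: "w \<in> W" for w
      proof (rule inj_onD[OF base.inj_on_incl2])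
        show "base.i2 (proj B2 (q w)) = base.i2 x"
        proof -
          have "q w \<in> points (total B2)" "w \<in> U" using qW 2(2) w by auto
          then show ?thesis using pG[of w] 2(4)[OF w] proj_glue2[of "q w"] by simp
        qed
        show "proj B2 (q w) \<in> points (base B2)" using qW w proj2 by auto
      qed fact
      then have "plots (fibre_space B2 x) n W q"
        using 2(3) qW by (auto simp: plots_fibre_space_iff over_def)
      then show ?thesis using 2 by blast
    qed
  qed
qed

lemma pull1_surj:
  assumes "x \<in> points (base B1) - Y" "\<phi> \<in> dual1 x"
  obtains \<eta> where "\<eta> \<in> dualG (base.i1 x)" "pull1 x \<eta> = \<phi>"
proof -
  have "\<phi> \<in> pull1 x ` dualG (base.i1 x)"
    using assms(2) unfolding bij_betw_imp_surj_on[OF bij_betw_pull1[OF assms(1)]] .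
  then show thesis by (elim imageE) (rule that, simp_all)
qed

lemma pull2_surj:
  assumes "x \<in> points (base B2)" "\<phi> \<in> dual2 x"
  obtains \<eta> where "\<eta> \<in> dualG (base.i2 x)" "pull2 x \<eta> = \<phi>"
proof -
  have "\<phi> \<in> pull2 x ` dualG (base.i2 x)"
    using assms(2) unfolding bij_betw_imp_surj_on[OF bij_betw_pull2[OF assms(1)]] .
  then show thesis by (elim imageE) (rule that, simp_all)
qed

lemma dual_metric_glue1:
  assumes x: "x \<in> points (base B1) - Y" and \<eta>: "\<eta> \<in> dualG (base.i1 x)" "\<eta>' \<in> dualG (base.i1 x)"
  shows "dual_metric G (glue_metric B1 B2 Y ft g1 g2) (base.i1 x) (base.i1 x, \<eta>) (base.i1 x, \<eta>') =
    dual_metric B1 g1 x (x, pull1 x \<eta>) (x, pull1 x \<eta>')"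
proof (rule dual_metric_image)
  show "proj B1 v = x" if "v \<in> carrier (fibre B1 x)" for v
    using that x pb1 by (simp add: proj_carrier_fibre)
  show "proj G (total.i1 v) = base.i1 x" if "v \<in> carrier (fibre B1 x)" for v
    using incl1_mem_over[OF x, of v] that x by (simp add: carrier_fibre1 over_def[of G])
qed (use x \<eta> in \<open>simp_all add: carrier_glue1 glue_metric1 mem_smooth_dual_iff\<close>)

lemma dual_metric_glue2:
  assumes x: "x \<in> points (base B2)" and \<eta>: "\<eta> \<in> dualG (base.i2 x)" "\<eta>' \<in> dualG (base.i2 x)"
  shows "dual_metric G (glue_metric B1 B2 Y ft g1 g2) (base.i2 x) (base.i2 x, \<eta>) (base.i2 x, \<eta>') =
    dual_metric B2 g2 x (x, pull2 x \<eta>) (x, pull2 x \<eta>')"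
proof (rule dual_metric_image)
  show "proj B2 v = x" if "v \<in> carrier (fibre B2 x)" for v
    using that x pb2 by (simp add: proj_carrier_fibre)
  show "proj G (total.i2 v) = base.i2 x" if "v \<in> carrier (fibre B2 x)" for v
    using incl2_mem_over[of v x] that x by (simp add: carrier_fibre2 over_def[of G])
qed (use x \<eta> in \<open>simp_all add: carrier_glue2 glue_metric2 mem_smooth_dual_iff\<close>)

end

text \<open>Records the consequences of the two diffeomorphism hypotheses on which the comparison of
  the duals rests.\<close>

locale glue_duals = glue_pseudo_bundles B1 B2 Y f ft
  for B1 :: "('x1, 'v1) pbundle" and B2 :: "('x2, 'v2) pbundle"
    and Y :: "'x1 set" and f :: "'x1 \<Rightarrow> 'x2" and ft :: "'v1 \<Rightarrow> 'v2" +
  assumes inj_f: "inj_on f Y"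
    and inj_lift: "inj_on (dual_lift B1 Y ft f) (over (dual_bundle B2) (f ` Y))"
    and lift_total: "dual_lift B1 Y ft f ` over (dual_bundle B2) (f ` Y) \<subseteq> points (total (dual_bundle B1))"
begin

abbreviation "lift \<equiv> dual_lift B1 Y ft f"
abbreviation "f_inv \<equiv> inv_into Y f"

text \<open>Dualising reverses the direction: the dual of \<open>B2\<close> becomes the first
  summand, glued along \<open>f_inv\<close>.\<close>

sublocale dual: glue_bundles "dual_bundle B2" "dual_bundle B1" "f ` Y" f_inv lift
proof unfold_locales
  show "f_inv ` f ` Y \<subseteq> points (base (dual_bundle B1))"
    using gluingD(1) inv_into_into[of _ f Y] by (auto simp: dual_bundle_simps)
  show "proj (dual_bundle B1) (lift v) = f_inv (proj (dual_bundle B2) v)" for v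
    by (simp add: dual_bundle_simps dual_lift_def Let_def split: prod.split)
qed (use gluingD(1,2) lift_total in
    \<open>auto simp: dual_bundle_simps carrier_dual_fibre over_dual_bundle mem_points_dual_bundle[unfolded dual_bundle_simps]\<close>)

section \<open>Injectivity and inverse of the gluing-dual commutativity map\<close>

abbreviation "Phi \<equiv> Phi_dual B1 B2 Y ft f"

lemma Phi_incl1: "x \<in> points (base B1) - Y \<Longrightarrow> Phi (base.i1 x, \<eta>) = dual.total.i2 (x, pull1 x \<eta>)"
  by (simp add: Phi_dual_def base.unglue_incl Let_def)

lemma Phi_incl2:
  "x \<in> points (base B2) \<Longrightarrow> Phi (base.i2 x, \<eta>) =
     (if x \<in> f ` Y then dual.total.i2 (lift (x, pull2 x \<eta>)) else dual.total.i1 (x, pull2 x \<eta>))"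
  by (simp add: Phi_dual_def base.unglue_incl Let_def)

text \<open>A left inverse is read off from \<open>unglue\<close>: the summand and the base point
  tell which of the three formulas for \<open>Phi\<close> was applied, and each is undone by
  inverting \<open>pull1\<close>, \<open>pull2\<close> or \<open>lift\<close>.\<close>

lemma inj_on_Phi: "inj_on Phi (points (total (dual_bundle G)))"
proof (rule inj_on_inverseI)
  let ?dec = "\<lambda>k. case unglue k of
      Inr (x, \<phi>) \<Rightarrow> if x \<in> Y
        then let (z, \<xi>) = inv_into (over (dual_bundle B2) (f ` Y)) lift (x, \<phi>)
             in (base.i2 z, inv_into (dualG (base.i2 z)) (pull2 z) \<xi>)
        else (base.i1 x, inv_into (dualG (base.i1 x)) (pull1 x) \<phi>)
    | Inl (z, \<xi>) \<Rightarrow> (base.i2 z, inv_into (dualG (base.i2 z)) (pull2 z) \<xi>)"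
  fix e assume "e \<in> points (total (dual_bundle G))"
  then obtain c \<eta> where e: "e = (c, \<eta>)" "c \<in> points (base G)" "\<eta> \<in> dualG c"
    by (cases e) (auto simp: mem_points_dual_bundle)
  from e(2) consider x where "x \<in> points (base B1) - Y" "c = base.i1 x"
    | x where "x \<in> points (base B2)" "c = base.i2 x"
    by (auto simp: base.points_glue)
  then show "?dec (Phi e) = e"
  proof cases
    case (1 x)
    note b = bij_betw_pull1[OF 1(1)]
    have "pull1 x \<eta> \<in> dual1 x" using bij_betwE[OF b] e(3) 1(2) by blast
    then have "(x, pull1 x \<eta>) \<in> points (total (dual_bundle B1))"
      using 1(1) by (simp add: mem_points_dual_bundle)
    then have "unglue (Phi e) = Inr (x, pull1 x \<eta>)"
      using 1 e(1) by (simp add: Phi_incl1 dual.total.unglue_incl)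
    moreover have "inv_into (dualG (base.i1 x)) (pull1 x) (pull1 x \<eta>) = \<eta>"
      using bij_betw_inv_into_left[OF b] e(3) 1(2) by blast
    ultimately show ?thesis using 1 e(1) by simp
  next
    case (2 x)
    note b = bij_betw_pull2[OF 2(1)]
    have p: "pull2 x \<eta> \<in> dual2 x" using bij_betwE[OF b] e(3) 2(2) by blast
    have inv: "inv_into (dualG (base.i2 x)) (pull2 x) (pull2 x \<eta>) = \<eta>"
      using bij_betw_inv_into_left[OF b] e(3) 2(2) by blast
    show ?thesis
    proof (cases "x \<in> f ` Y")
      case True
      then have mem: "(x, pull2 x \<eta>) \<in> over (dual_bundle B2) (f ` Y)"
        using 2(1) p by (simp add: over_dual_bundle)
      \<comment> \<open>The base component of a lifted covector is \<open>f_inv x\<close>, which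
        lies in \<open>Y\<close>; this is how \<open>?dec\<close> recognises that
        \<open>lift\<close> was applied.\<close>
      obtain \<phi> where \<phi>: "lift (x, pull2 x \<eta>) = (f_inv x, \<phi>)"
        by (simp add: dual_lift_def Let_def)
      have "f_inv x \<in> Y" using True by (rule inv_into_into)
      moreover have "lift (x, pull2 x \<eta>) \<in> points (total (dual_bundle B1))" using lift_total mem by blast
      then have "unglue (Phi e) = Inr (f_inv x, \<phi>)"
        using 2 e(1) True by (simp add: Phi_incl2 dual.total.unglue_incl \<phi>)
      moreover have "inv_into (over (dual_bundle B2) (f ` Y)) lift (f_inv x, \<phi>) = (x, pull2 x \<eta>)"
        using inv_into_f_f[OF inj_lift mem] \<phi> by simp
      ultimately show ?thesis using 2 e(1) inv by simp
    next
      case False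
      then have "(x, pull2 x \<eta>) \<in> points (total (dual_bundle B2)) - over (dual_bundle B2) (f ` Y)"
        using 2(1) p by (simp add: mem_points_dual_bundle over_dual_bundle)
      then have "unglue (Phi e) = Inl (x, pull2 x \<eta>)"
        using 2 e(1) False by (simp add: Phi_incl2 dual.total.unglue_incl)
      then show ?thesis using 2 e(1) inv by simp
    qed
  qed
qed

text \<open>By injectivity an exhibited preimage is the value of the inverse. Surjectivity of
  \<open>Phi\<close> is thus handled by producing preimages fibre by fibre.\<close>

lemma Phi_inv_eq:
  "c \<in> points (base G) \<Longrightarrow> \<eta> \<in> dualG c \<Longrightarrow> Phi (c, \<eta>) = k \<Longrightarrow> Phi_dual_inv B1 B2 Y ft f k = (c, \<eta>)"
  unfolding Phi_dual_inv_def using inv_into_f_f[OF inj_on_Phi, of "(c, \<eta>)"]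
  by (simp add: mem_points_dual_bundle)

text \<open>Every covector over \<open>y\<close> is some \<open>Psi B1 g1 v\<close>, which
  compatibility identifies with the lift of \<open>Psi B2 g2 (ft v)\<close>. So \<open>lift\<close>
  covers the fibre, and both dual forms can be evaluated on such representatives.\<close>

lemma glue_metric_dual:
  assumes fd: "finite_dimensional B1" and fd2: "finite_dimensional B2" and g1: "pseudo_metric B1 g1" and g2: "pseudo_metric B2 g2"
    and comp: "compatible B1 Y ft f g1 g2" and y: "y \<in> Y"
  shows "over (dual_bundle B1) {y} \<subseteq> lift ` over (dual_bundle B2) {f y}"
    and "\<xi> \<in> over (dual_bundle B2) {f y} \<Longrightarrow> \<xi>' \<in> over (dual_bundle B2) {f y} \<Longrightarrow>
      dual_metric B1 g1 y (lift \<xi>) (lift \<xi>') = dual_metric B2 g2 (f y) \<xi> \<xi>'"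
proof -
  have yB: "y \<in> points (base B1)" and fyB: "f y \<in> points (base B2)" using y gluingD(1,2) by auto
  note proj1 = proj_carrier_fibre[OF pb1 yB] and proj2 = proj_carrier_fibre[OF pb2 fyB]
  have ft: "ft v \<in> carrier (fibre B2 (f y))" if "v \<in> carrier (fibre B1 y)" for v
  proof -
    have "v \<in> over B1 Y" using that y yB by (simp add: carrier_fibre1 over_def)
    then show ?thesis
      using gluingD(3) gluingD(4)[of v] proj1[OF that] fyB by (auto simp: carrier_fibre2 over_def[of B2])
  qed
  have sym1: "g1 y v w = g1 y w v" if "v \<in> carrier (fibre B1 y)" "w \<in> carrier (fibre B1 y)" for v w
    using g1 yB that by (auto simp: pseudo_metric_def vs_pseudo_metric_def)
  have sym2: "g2 (f y) v w = g2 (f y) w v"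
    if "v \<in> carrier (fibre B2 (f y))" "w \<in> carrier (fibre B2 (f y))" for v w
    using g2 fyB that by (auto simp: pseudo_metric_def vs_pseudo_metric_def)
  have compat: "g1 y v w = g2 (f y) (ft v) (ft w)"
    if "v \<in> carrier (fibre B1 y)" "w \<in> carrier (fibre B1 y)" for v w
    using comp y that by (simp add: compatible_def)
  \<comment> \<open>Injectivity of \<open>f\<close> makes \<open>f_inv\<close> return
    \<open>y\<close> at \<open>f y\<close>; the equality of functionals is then
    compatibility.\<close>
  have lift_Psi: "lift (Psi B2 g2 (ft v)) = Psi B1 g1 v" if v: "v \<in> carrier (fibre B1 y)" for v
    using proj1[OF v] proj2[OF ft[OF v]] inj_f y v ft compat
    by (auto simp: Psi_def dual_lift_def intro!: restrict_ext)
  \<comment> \<open>From \<open>Psi_surj\<close> only the inclusion matters here: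
    \<open>Psi B2 g2\<close> takes values in the smooth dual.\<close>
  have Psi_mem: "Psi B2 g2 (ft v) \<in> over (dual_bundle B2) {f y}" if "v \<in> carrier (fibre B1 y)" for v
    using Psi_surj[OF pb2 fd2 g2 fyB] ft[OF that] by blast
  show "over (dual_bundle B1) {y} \<subseteq> lift ` over (dual_bundle B2) {f y}"
  proof
    fix \<phi> assume "\<phi> \<in> over (dual_bundle B1) {y}"
    then obtain v where "v \<in> carrier (fibre B1 y)" "\<phi> = Psi B1 g1 v"
      using Psi_surj[OF pb1 fd g1 yB] by blast
    then show "\<phi> \<in> lift ` over (dual_bundle B2) {f y}" using lift_Psi Psi_mem by force
  qed
  \<comment> \<open>Surjectivity of \<open>Psi B2 g2\<close> gives a representing vector, but
    possibly outside the range of \<open>ft\<close>. Instead \<open>\<xi>\<close> is lifted to the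
    fibre over \<open>y\<close>, represented there, and injectivity of \<open>lift\<close> brings
    the representation back.\<close>
  have ex: "\<exists>v\<in>carrier (fibre B1 y). \<xi> = Psi B2 g2 (ft v)" if \<xi>: "\<xi> \<in> over (dual_bundle B2) {f y}" for \<xi>
  proof -
    have sub: "over (dual_bundle B2) {f y} \<subseteq> over (dual_bundle B2) (f ` Y)" using y by (auto simp: over_def)
    have "lift \<xi> \<in> points (total (dual_bundle B1))" using lift_total \<xi> sub by blast
    moreover have "fst (lift \<xi>) = y"
      using \<xi> inj_f y by (auto simp: over_dual_bundle dual_lift_def Let_def)
    ultimately have "lift \<xi> \<in> over (dual_bundle B1) {y}" by (simp add: over_def dual_bundle_simps)
    then obtain v where v: "v \<in> carrier (fibre B1 y)" "lift \<xi> = Psi B1 g1 v"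
      using Psi_surj[OF pb1 fd g1 yB] by blast
    then have "lift \<xi> = lift (Psi B2 g2 (ft v))" using lift_Psi by simp
    then have "\<xi> = Psi B2 g2 (ft v)"
      using inj_onD[OF inj_lift] \<xi> Psi_mem[OF v(1)] sub by blast
    then show ?thesis using v(1) by blast
  qed
  assume "\<xi> \<in> over (dual_bundle B2) {f y}" "\<xi>' \<in> over (dual_bundle B2) {f y}"
  then obtain v w where v: "v \<in> carrier (fibre B1 y)" "\<xi> = Psi B2 g2 (ft v)"
    and w: "w \<in> carrier (fibre B1 y)" "\<xi>' = Psi B2 g2 (ft w)" using ex by meson
  have "dual_metric B1 g1 y (Psi B1 g1 v) (Psi B1 g1 w) = g1 y v w"
    by (rule dual_metric_Psi) (use proj1 sym1 v w in auto)
  moreover have "dual_metric B2 g2 (f y) (Psi B2 g2 (ft v)) (Psi B2 g2 (ft w)) = g2 (f y) (ft v) (ft w)"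
    by (rule dual_metric_Psi) (use proj2 sym2 ft v w in auto)
  ultimately show "dual_metric B1 g1 y (lift \<xi>) (lift \<xi>') = dual_metric B2 g2 (f y) \<xi> \<xi>'"
    using v w lift_Psi compat by simp
qed

section \<open>Comparison of the two forms over the three regions of the base\<close>

lemma switch_map_incl:
  "x \<in> points (base B1) - Y \<Longrightarrow> switch_map B1 B2 Y f (base.i1 x) = dual.base.i2 x"
  "y \<in> Y \<Longrightarrow> switch_map B1 B2 Y f (base.i2 (f y)) = dual.base.i2 y"
  "z \<in> points (base B2) - f ` Y \<Longrightarrow> switch_map B1 B2 Y f (base.i2 z) = dual.base.i1 z"
  using gluingD(2) inj_f by (auto simp: switch_map_def base.unglue_incl dual_bundle_simps)

text \<open>In each region a covector is exhibited as \<open>Phi (c, \<eta>)\<close>, so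
  \<open>(c, \<eta>)\<close> is its image under the inverse. Both sides then reduce to dual forms of
  \<open>B1\<close> or \<open>B2\<close>, which differ only over the image of \<open>Y\<close> and
  are matched there by \<open>glue_metric_dual\<close>.\<close>

lemma dual_glue_metric_switch:
  assumes fd: "finite_dimensional B1" and fd2: "finite_dimensional B2" and g1: "pseudo_metric B1 g1" and g2: "pseudo_metric B2 g2"
    and comp: "compatible B1 Y ft f g1 g2" and c: "c \<in> points (base G)"
    and v: "v \<in> carrier (fibre dual.G (switch_map B1 B2 Y f c))"
    and w: "w \<in> carrier (fibre dual.G (switch_map B1 B2 Y f c))"
  shows "dual_glue_metric B1 B2 Y ft f g1 g2 (switch_map B1 B2 Y f c) v w =
    dual_metric G (glue_metric B1 B2 Y ft g1 g2) c
      (Phi_dual_inv B1 B2 Y ft f v) (Phi_dual_inv B1 B2 Y ft f w)"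
proof -
  from c consider x where "x \<in> points (base B1) - Y" "c = base.i1 x"
    | y where "y \<in> Y" "c = base.i2 (f y)"
    | z where "z \<in> points (base B2) - f ` Y" "c = base.i2 z"
    unfolding glue_bundle_simps base.points_glue by blast
  then show ?thesis
  proof cases
    case (1 x)
    then have x: "x \<in> points (base (dual_bundle B1))" by (simp add: dual_bundle_simps)
    \<comment> \<open>Membership of the pulled-back covector in its fibre is recorded because the
      evaluation rule for the glued form requires it.\<close>
    have key: "\<exists>\<eta>\<in>dualG c. u = dual.total.i2 (x, pull1 x \<eta>) \<and> (x, pull1 x \<eta>) \<in> carrier (fibre (dual_bundle B1) x) \<and>
        Phi_dual_inv B1 B2 Y ft f u = (c, \<eta>)"
      if u: "u \<in> carrier (fibre dual.G (switch_map B1 B2 Y f c))" for u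
    proof -
      obtain \<phi> where \<phi>: "\<phi> \<in> dual1 x" "u = dual.total.i2 (x, \<phi>)"
        using u unfolding 1(2) switch_map_incl(1)[OF 1(1)] dual.carrier_glue2[OF x] carrier_fibre_dual_bundle
        by blast
      obtain \<eta> where \<eta>: "\<eta> \<in> dualG c" "pull1 x \<eta> = \<phi>"
        using pull1_surj[OF 1(1) \<phi>(1)] unfolding 1(2) .
      have "Phi_dual_inv B1 B2 Y ft f u = (c, \<eta>)"
        by (rule Phi_inv_eq[OF c \<eta>(1)]) (use \<phi>(2) \<eta>(2) 1 in \<open>simp add: Phi_incl1\<close>)
      then show ?thesis using \<phi> \<eta> by (intro bexI[of _ \<eta>]) (simp_all add: carrier_fibre_dual_bundle)
    qed
    from key[OF v] key[OF w] show ?thesis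
      using 1 by (auto simp: switch_map_incl dual_glue_metric_def dual.glue_metric2[OF x] dual_metric_glue1)
  next
    case (2 y)
    have y: "y \<in> points (base (dual_bundle B1))" and fy: "f y \<in> points (base B2)" "f y \<in> f ` Y"
      using 2(1) gluingD(1,2) by (auto simp: dual_bundle_simps)
    have yB: "y \<in> points (base B1)" using y by (simp add: dual_bundle_simps)
    note gm = glue_metric_dual[OF fd fd2 g1 g2 comp 2(1)]
    \<comment> \<open>Two preimages are taken in turn: under \<open>lift\<close>, which covers the
      dual fibre over \<open>y\<close>, and then under \<open>pull2\<close>.\<close>
    have key: "\<exists>\<eta>\<in>dualG c. u = dual.total.i2 (lift (f y, pull2 (f y) \<eta>)) \<and>
        lift (f y, pull2 (f y) \<eta>) \<in> carrier (fibre (dual_bundle B1) y) \<and>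
        (f y, pull2 (f y) \<eta>) \<in> over (dual_bundle B2) {f y} \<and>
        Phi_dual_inv B1 B2 Y ft f u = (c, \<eta>)"
      if u: "u \<in> carrier (fibre dual.G (switch_map B1 B2 Y f c))" for u
    proof -
      obtain \<phi> where \<phi>: "\<phi> \<in> over (dual_bundle B1) {y}" "u = dual.total.i2 \<phi>"
        using u unfolding 2(2) switch_map_incl(2)[OF 2(1)] dual.carrier_glue2[OF y] carrier_dual_fibre[OF yB]
        by blast
      then obtain \<xi> where \<xi>: "(f y, \<xi>) \<in> over (dual_bundle B2) {f y}" "\<phi> = lift (f y, \<xi>)"
        using gm(1) by (auto simp: over_dual_bundle)
      then have "\<xi> \<in> dual2 (f y)" by (simp add: over_dual_bundle)
      then obtain \<eta> where \<eta>: "\<eta> \<in> dualG c" "pull2 (f y) \<eta> = \<xi>"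
        using pull2_surj[OF fy(1)] unfolding 2(2) by blast
      have "Phi_dual_inv B1 B2 Y ft f u = (c, \<eta>)"
        by (rule Phi_inv_eq[OF c \<eta>(1)]) (use \<phi>(2) \<eta>(2) \<xi>(2) 2 fy in \<open>simp add: Phi_incl2\<close>)
      then show ?thesis using \<phi> \<eta> \<xi> by (intro bexI[of _ \<eta>]) (simp_all add: carrier_dual_fibre[OF yB])
    qed
    from key[OF v] key[OF w] show ?thesis
      using 2 fy by (auto simp: switch_map_incl dual_glue_metric_def dual.glue_metric2[OF y] dual_metric_glue2 gm(2))
  next
    case (3 z)
    then have z: "z \<in> points (base (dual_bundle B2)) - f ` Y" and zB: "z \<in> points (base B2)"
      by (simp_all add: dual_bundle_simps)
    have key: "\<exists>\<eta>\<in>dualG c. u = dual.total.i1 (z, pull2 z \<eta>) \<and> (z, pull2 z \<eta>) \<in> carrier (fibre (dual_bundle B2) z) \<and>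
        Phi_dual_inv B1 B2 Y ft f u = (c, \<eta>)"
      if u: "u \<in> carrier (fibre dual.G (switch_map B1 B2 Y f c))" for u
    proof -
      obtain \<xi> where \<xi>: "\<xi> \<in> dual2 z" "u = dual.total.i1 (z, \<xi>)"
        using u unfolding 3(2) switch_map_incl(3)[OF 3(1)] dual.carrier_glue1[OF z] carrier_fibre_dual_bundle
        by blast
      obtain \<eta> where \<eta>: "\<eta> \<in> dualG c" "pull2 z \<eta> = \<xi>"
        using pull2_surj[OF zB \<xi>(1)] unfolding 3(2) .
      have "Phi_dual_inv B1 B2 Y ft f u = (c, \<eta>)"
        by (rule Phi_inv_eq[OF c \<eta>(1)]) (use \<xi>(2) \<eta>(2) 3 in \<open>simp add: Phi_incl2\<close>)
      then show ?thesis using \<xi> \<eta> by (intro bexI[of _ \<eta>]) (simp_all add: carrier_fibre_dual_bundle)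
    qed
    from key[OF v] key[OF w] show ?thesis
      using 3 by (auto simp: switch_map_incl dual_glue_metric_def dual.glue_metric1[OF z] dual_metric_glue2)
  qed
qed

end

theorem theorem5p1:
  fixes B1 :: "('x1, 'v1) pbundle" and B2 :: "('x2, 'v2) pbundle"
    and Y :: "'x1 set" and f :: "'x1 \<Rightarrow> 'x2" and ft :: "'v1 \<Rightarrow> 'v2"
    and g1 :: "'x1 \<Rightarrow> 'v1 \<Rightarrow> 'v1 \<Rightarrow> real" and g2 :: "'x2 \<Rightarrow> 'v2 \<Rightarrow> 'v2 \<Rightarrow> real"
  assumes "pseudo_bundle B1" and "finite_dimensional B1" and "locally_trivial B1"
    and "pseudo_bundle B2" and "finite_dimensional B2" and "locally_trivial B2"
    and "gluing B1 B2 Y ft f"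
    and "diffeomorphism (sub_dspace (base B1) Y) (sub_dspace (base B2) (f ` Y)) f"
    and "diffeomorphism
           (sub_dspace (dual_total B2) (over (dual_bundle B2) (f ` Y)))
           (sub_dspace (dual_total B1) (dual_lift B1 Y ft f ` over (dual_bundle B2) (f ` Y)))
           (dual_lift B1 Y ft f)"
    and "pseudo_metric B1 g1" and "pseudo_metric B2 g2"
    and "compatible B1 Y ft f g1 g2"
  shows "\<forall>x \<in> points (base (glue_bundle B1 B2 Y ft f)).
           \<forall>v \<in> carrier (fibre (dual_glue_bundle B1 B2 Y ft f) (switch_map B1 B2 Y f x)).
           \<forall>w \<in> carrier (fibre (dual_glue_bundle B1 B2 Y ft f) (switch_map B1 B2 Y f x)).
             dual_glue_metric B1 B2 Y ft f g1 g2 (switch_map B1 B2 Y f x) v w =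
             dual_metric (glue_bundle B1 B2 Y ft f) (glue_metric B1 B2 Y ft g1 g2) x
               (Phi_dual_inv B1 B2 Y ft f v) (Phi_dual_inv B1 B2 Y ft f w)"
proof (intro ballI)
  interpret glue_duals B1 B2 Y f ft
  proof
    show "pseudo_bundle B1" "pseudo_bundle B2" "gluing B1 B2 Y ft f" by fact+
    have Y: "Y \<subseteq> points (base B1)" using assms(7) by (simp add: gluing_def)
    have "points (base B1) \<inter> Y = Y" using Y by blast
    then show "inj_on f Y"
      using assms(8) by (auto simp: diffeomorphism_def sub_dspace_def bij_betw_def)
    have "points (dual_total B2) \<inter> over (dual_bundle B2) (f ` Y) = over (dual_bundle B2) (f ` Y)"
      by (auto simp: over_def dual_bundle_simps)
    \<comment> \<open>The target is the image of the lift cut down to \<open>dual_total B1\<close>;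
      bijectivity onto this intersection forces the whole image into
      \<open>dual_total B1\<close>.\<close>
    then have "bij_betw (dual_lift B1 Y ft f) (over (dual_bundle B2) (f ` Y))
        (points (dual_total B1) \<inter> dual_lift B1 Y ft f ` over (dual_bundle B2) (f ` Y))"
      using assms(9) unfolding diffeomorphism_def sub_dspace_def by simp
    then show "inj_on (dual_lift B1 Y ft f) (over (dual_bundle B2) (f ` Y))"
      "dual_lift B1 Y ft f ` over (dual_bundle B2) (f ` Y) \<subseteq> points (total (dual_bundle B1))"
      unfolding bij_betw_def dual_bundle_simps by blast+
  qed
  fix x v w
  assume "x \<in> points (base (glue_bundle B1 B2 Y ft f))"
    "v \<in> carrier (fibre (dual_glue_bundle B1 B2 Y ft f) (switch_map B1 B2 Y f x))"
    "w \<in> carrier (fibre (dual_glue_bundle B1 B2 Y ft f) (switch_map B1 B2 Y f x))"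
  then show "dual_glue_metric B1 B2 Y ft f g1 g2 (switch_map B1 B2 Y f x) v w =
      dual_metric (glue_bundle B1 B2 Y ft f) (glue_metric B1 B2 Y ft g1 g2) x
        (Phi_dual_inv B1 B2 Y ft f v) (Phi_dual_inv B1 B2 Y ft f w)"
    unfolding dual_glue_bundle_def by (rule dual_glue_metric_switch[OF assms(2,5,10,11,12)])
qed

end
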